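(* Let $F\colon\mathbb{T}\to\mathbb{T}$ be an orientation-preserving $C^{11}$ diffeomorphism of the circle $\mathbb{T}=\mathbb{R}/\mathbb{Z}$ with irrational rotation number, let $\mu$ be its unique invariant Borel probability measure, and let $(q_n)_{n\ge 0}$ be the sequence of denominators of the convergents of the continued fraction expansion of the rotation number of $F$. If $\phi\colon\mathbb{T}\to\mathbb{R}$ is $C^1$, then $$\left\|\sum_{i=0}^{q_n-1}\phi\circ F^i-q_n\int_{\mathbb{T}}\phi\,d\mu\right\|_{C^0}\to 0\quad\text{as } n\to\infty.$$
   Context: For an irrational $\alpha\in\mathbb{R}$ (any representative of the rotation number of $F$ modulo $\mathbb{Z}$), with continued fraction expansion $\alpha=[a_0;a_1,a_2,\dots]$, the denominators are given by $q_{-2}=1$, $q_{-1}=0$, $q_n=a_nq_{n-1}+q_{n-2}$ for $n\ge 0$; they depend only on $\alpha$ modulo $\mathbb{Z}$. $\|\cdot\|_{C^0}$ is the supremum norm on $\mathbb{T}$. *)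

theory Defs
  imports "HOL-Probability.Probability"
begin

section \<open>The circle $\mathbb{R}/\mathbb{Z}$\<close>

quotient_type circle = real / "\<lambda>x y. x - y \<in> \<int>"
proof (rule equivpI)
  show "reflp (\<lambda>x y :: real. x - y \<in> \<int>)"
    by (simp add: reflp_def)
  show "symp (\<lambda>x y :: real. x - y \<in> \<int>)"
  proof (rule sympI)
    fix x y :: real
    assume "x - y \<in> \<int>"
    then have "- (x - y) \<in> \<int>" by (rule Ints_minus)
    then show "y - x \<in> \<int>" by simp
  qed
  show "transp (\<lambda>x y :: real. x - y \<in> \<int>)"
  proof (rule transpI)
    fix x y z :: real
    assume "x - y \<in> \<int>" "y - z \<in> \<int>"
    then have "(x - y) + (y - z) \<in> \<int>" by (rule Ints_add)
    then show "x - z \<in> \<int>" by simp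
  qed
qed

lift_definition to_circle :: "real \<Rightarrow> circle" is "\<lambda>x. x" .

text \<open>The quotient topology; the \<sigma>-algebra \<open>borel :: circle measure\<close> refers to it.\<close>

instantiation circle :: topological_space
begin

definition open_circle :: "circle set \<Rightarrow> bool"
  where "open_circle U \<longleftrightarrow> open (to_circle -` U)"

instance
  by standard (simp_all add: open_circle_def vimage_Union open_Int open_UN)

end


section \<open>Regularity and orientation\<close>

definition Ck_real :: "nat \<Rightarrow> (real \<Rightarrow> real) \<Rightarrow> bool"
  where "Ck_real k f \<longleftrightarrow>
    (\<forall>j<k. \<forall>x. (deriv ^^ j) f field_differentiable at x) \<and> continuous_on UNIV ((deriv ^^ k) f)"

definition circle_lift :: "(real \<Rightarrow> real) \<Rightarrow> (circle \<Rightarrow> circle) \<Rightarrow> bool"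
  where "circle_lift f F \<longleftrightarrow>
    continuous_on UNIV f \<and> (\<forall>x. to_circle (f x) = F (to_circle x))"

text \<open>
  Since \<open>to_circle\<close> is a smooth covering map, a map of the circle is of class \<open>C\<^sup>k\<close> iff it
  has a lift of class \<open>C\<^sup>k\<close>, and a real function on the circle is of class \<open>C\<^sup>k\<close> iff its pullback
  to the line is.
\<close>

definition Ck_circle_map :: "nat \<Rightarrow> (circle \<Rightarrow> circle) \<Rightarrow> bool"
  where "Ck_circle_map k F \<longleftrightarrow> (\<exists>f. circle_lift f F \<and> Ck_real k f)"

definition Ck_circle_fun :: "nat \<Rightarrow> (circle \<Rightarrow> real) \<Rightarrow> bool"
  where "Ck_circle_fun k \<phi> \<longleftrightarrow> Ck_real k (\<phi> \<circ> to_circle)"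

definition circle_diffeo :: "nat \<Rightarrow> (circle \<Rightarrow> circle) \<Rightarrow> bool"
  where "circle_diffeo k F \<longleftrightarrow> bij F \<and> Ck_circle_map k F \<and> Ck_circle_map k (inv F)"

definition orientation_preserving :: "(circle \<Rightarrow> circle) \<Rightarrow> bool"
  where "orientation_preserving F \<longleftrightarrow> (\<exists>f. circle_lift f F \<and> strict_mono f)"


section \<open>Rotation number and invariant measures\<close>

text \<open>
  The rotation number of an orientation-preserving homeomorphism is an element of the circle; the
  following says that the real number \<open>\<alpha>\<close> represents it. Different lifts differ by an integer
  constant, so that \<open>\<alpha>\<close> is determined by \<open>F\<close> exactly up to addition of an integer.
\<close>

definition represents_rotation_number :: "real \<Rightarrow> (circle \<Rightarrow> circle) \<Rightarrow> bool"
  where "represents_rotation_number \<alpha> F \<longleftrightarrow>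
    (\<exists>f. circle_lift f F \<and> (\<forall>x. (\<lambda>n. ((f ^^ n) x - x) / real n) \<longlonglongrightarrow> \<alpha>))"

definition invariant_borel_probability :: "(circle \<Rightarrow> circle) \<Rightarrow> circle measure \<Rightarrow> bool"
  where "invariant_borel_probability F \<mu> \<longleftrightarrow>
    prob_space \<mu> \<and> sets \<mu> = sets borel \<and> F \<in> borel \<rightarrow>\<^sub>M borel \<and> distr \<mu> borel F = \<mu>"


section \<open>Continued fractions\<close>

primrec cf_complete_quotient :: "real \<Rightarrow> nat \<Rightarrow> real"
  where
    "cf_complete_quotient \<alpha> 0 = \<alpha>"
  | "cf_complete_quotient \<alpha> (Suc n) = 1 / frac (cf_complete_quotient \<alpha> n)"

definition cf_partial_quotient :: "real \<Rightarrow> nat \<Rightarrow> int"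
  where "cf_partial_quotient \<alpha> n = \<lfloor>cf_complete_quotient \<alpha> n\<rfloor>"

text \<open>The index is shifted by 2: \<open>cf_denom_shifted \<alpha> n\<close> is \<open>q\<^bsub>n-2\<^esub>\<close>, so the recursion starts
  from \<open>q\<^bsub>-2\<^esub> = 1\<close> and \<open>q\<^bsub>-1\<^esub> = 0\<close>.\<close>

fun cf_denom_shifted :: "real \<Rightarrow> nat \<Rightarrow> int"
  where
    "cf_denom_shifted \<alpha> 0 = 1"
  | "cf_denom_shifted \<alpha> (Suc 0) = 0"
  | "cf_denom_shifted \<alpha> (Suc (Suc n)) =
       cf_partial_quotient \<alpha> n * cf_denom_shifted \<alpha> (Suc n) + cf_denom_shifted \<alpha> n"

text \<open>For irrational \<open>\<alpha>\<close> only \<open>a\<^sub>0\<close> can be nonpositive, and it is multiplied by \<open>q\<^bsub>-1\<^esub> = 0\<close>; hence the conversion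
  to \<^typ>\<open>nat\<close> never truncates.\<close>

definition cf_denom :: "real \<Rightarrow> nat \<Rightarrow> nat"
  where "cf_denom \<alpha> n = nat (cf_denom_shifted \<alpha> (n + 2))"


section \<open>Supremum norm\<close>

definition C0_norm :: "(circle \<Rightarrow> real) \<Rightarrow> real"
  where "C0_norm g = (SUP x. \<bar>g x\<bar>)"

end

theory Submission
  imports Defs
begin

text \<open>
  The proof takes place on the line, for the lift \<open>f\<close> of \<open>F\<close> with rotation number \<open>\<alpha>\<close>, and writes
  \<open>S\<^sub>q \<phi>\<close> for the Birkhoff sum \<open>\<Sum>j<q. \<phi> \<circ> f\<^sup>j\<close>. Integrating over \<open>y\<close> against the invariant measure shows
  that it suffices to make the oscillation \<open>\<bar>S\<^sub>q \<phi> x - S\<^sub>q \<phi> y\<bar>\<close> tend to \<open>0\<close> uniformly in \<open>x\<close> and \<open>y\<close>, when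
  \<open>q = q\<^sub>n\<close> (\<open>birkhoff_deviation\<close>).

  The classical Denjoy--Koksma inequality (\<open>denjoy_koksma\<close>) bounds this oscillation by a constant times
  the variation of \<open>\<phi>\<close>: in a monotone coordinate \<open>H\<close> that conjugates \<open>f\<close> to a translation, the first \<open>q\<close>
  points of any orbit are distributed almost like the multiples of \<open>1/q\<close>. On the other hand a
  coboundary \<open>\<psi> \<circ> f - \<psi>\<close> with \<open>\<psi>\<close> continuous has Birkhoff sums \<open>\<psi> \<circ> f\<^sup>q - \<psi>\<close>, which tend to \<open>0\<close> since
  the maps \<open>f\<^sup>q\<close> converge to the identity of the circle (\<open>eventually_return_close\<close>, a consequence of
  Denjoy's theorem \<open>H_strict_mono\<close>). The improvement from bounded to convergent therefore follows once \<open>\<phi>\<close> is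
  cohomologous to functions of arbitrarily small variation.

  Such functions are found among the averages of \<open>\<phi>\<close> along orbits, which are cohomologous to \<open>\<phi>\<close>. The key
  is that averaging over a suitable time contracts the variation by a fixed factor less than \<open>1\<close>
  (\<open>dominated_average\<close>). The derivative of \<open>S\<^sub>q \<phi>\<close> is \<open>\<Sum>j<q. \<phi>' (f\<^sup>j x) (f\<^sup>j)' x\<close>, and \<open>\<phi>'\<close> has mean zero, so
  its positive and negative parts have equal integrals. Denjoy's bounded distortion shows that the
  weighted sums of these two parts are both bounded below by a fixed fraction of \<open>\<Sum>j<q. (f\<^sup>j)' x\<close> times
  that integral, at every point \<open>x\<close> (\<open>eventually_averages_spread\<close>); this is the reason why \<open>f\<close> is
  ergodic with respect to Lebesgue measure. Hence a definite part of the two sums cancels, and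
  iterating the averaging makes the variation decay geometrically.
\<close>

section \<open>Convergents and the arithmetic of rotations\<close>

text \<open>
  The arithmetic of a convergent \<open>p/q\<close> that the dynamics sees: it is in lowest terms, here witnessed
  by an inverse \<open>u\<close> of \<open>p\<close> modulo \<open>q\<close>, and \<open>\<bar>\<alpha> - p/q\<bar> \<le> 1/q\<^sup>2\<close>.
\<close>

definition approx_denom :: "real \<Rightarrow> nat \<Rightarrow> bool"
  where "approx_denom \<alpha> q \<longleftrightarrow>
    0 < q \<and> (\<exists>p u. int q dvd u * p - 1 \<and> \<bar>real q * \<alpha> - of_int p\<bar> \<le> 1 / real q)"

text \<open>
  The numerators satisfy the same two-step recursion as the denominators; carrying consecutive
  values \<open>(p\<^bsub>n-2\<^esub>, p\<^bsub>n-1\<^esub>)\<close> as a pair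
  allows primitive recursion.
\<close>

primrec cf_num_pair :: "real \<Rightarrow> nat \<Rightarrow> int \<times> int"
  where
    "cf_num_pair \<alpha> 0 = (0, 1)"
  | "cf_num_pair \<alpha> (Suc n) =
       (snd (cf_num_pair \<alpha> n),
        cf_partial_quotient \<alpha> n * snd (cf_num_pair \<alpha> n) + fst (cf_num_pair \<alpha> n))"

lemma cf_complete_quotient_irrational:
  assumes "\<alpha> \<notin> \<rat>"
  shows "cf_complete_quotient \<alpha> n \<notin> \<rat>"
proof (induction n)
  case 0
  then show ?case using assms by simp
next
  case (Suc n)
  show ?case
  proof
    assume "cf_complete_quotient \<alpha> (Suc n) \<in> \<rat>"
    then have "1 / frac (cf_complete_quotient \<alpha> n) \<in> \<rat>" by simp
    from Rats_inverse[OF this] have "frac (cf_complete_quotient \<alpha> n) \<in> \<rat>"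
      by (simp only: inverse_divide div_by_1)
    then have "frac (cf_complete_quotient \<alpha> n) + of_int \<lfloor>cf_complete_quotient \<alpha> n\<rfloor> \<in> \<rat>"
      by (intro Rats_add Rats_of_int)
    with Suc show False by (simp add: frac_def)
  qed
qed

lemma cf_complete_quotient_gt_1:
  assumes "\<alpha> \<notin> \<rat>"
  shows "1 < cf_complete_quotient \<alpha> (Suc n)"
proof -
  have "frac (cf_complete_quotient \<alpha> n) \<noteq> 0"
    using cf_complete_quotient_irrational[OF assms, of n] Ints_subset_Rats by auto
  then have "0 < frac (cf_complete_quotient \<alpha> n)" using frac_ge_0 by (metis order_le_less)
  moreover have "frac (cf_complete_quotient \<alpha> n) < 1" by (rule frac_lt_1)
  ultimately show ?thesis by simp
qed

text \<open>
  The classical formula \<open>\<alpha> = (x\<^sub>n p\<^bsub>n-1\<^esub> + p\<^bsub>n-2\<^esub>) / (x\<^sub>n q\<^bsub>n-1\<^esub> + q\<^bsub>n-2\<^esub>)\<close>, with \<open>x\<^sub>n\<close> the complete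
  quotient, cleared of its denominator so that it also holds for \<open>n = 0\<close>.
\<close>

lemma cf_complete_quotient_convergents:
  assumes "\<alpha> \<notin> \<rat>"
  shows "\<alpha> * (cf_complete_quotient \<alpha> n * of_int (cf_denom_shifted \<alpha> (Suc n))
              + of_int (cf_denom_shifted \<alpha> n))
    = cf_complete_quotient \<alpha> n * of_int (snd (cf_num_pair \<alpha> n))
              + of_int (fst (cf_num_pair \<alpha> n))"
proof (induction n)
  case 0
  then show ?case by simp
next
  case (Suc n)
  define x where "x = cf_complete_quotient \<alpha> n"
  define a where "a = real_of_int (cf_partial_quotient \<alpha> n)"
  define y where "y = cf_complete_quotient \<alpha> (Suc n)"
  have y1: "1 < y" unfolding y_def by (rule cf_complete_quotient_gt_1[OF assms])
  have yeq: "y = 1 / (x - a)"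
    by (simp add: y_def x_def a_def cf_partial_quotient_def frac_def)
  with y1 have "x - a \<noteq> 0" by auto
  with yeq have yxa: "1 = y * (x - a)" by simp
  have step: "y * (a * s + t) + s = y * (x * s + t)" for s t :: real
  proof -
    have "s = y * (x - a) * s" using yxa by simp
    then show ?thesis by (simp add: algebra_simps)
  qed
  show ?case
    using Suc
    by (simp add: x_def[symmetric] a_def[symmetric] y_def[symmetric] step mult.left_commute
        del: cf_complete_quotient.simps)
qed

lemma cf_convergents_det:
  "cf_denom_shifted \<alpha> (Suc n) * fst (cf_num_pair \<alpha> n)
     - cf_denom_shifted \<alpha> n * snd (cf_num_pair \<alpha> n) = - ((-1) ^ n)"
  by (induction n) (simp_all add: algebra_simps)

lemma cf_denom_shifted_growth:
  assumes "\<alpha> \<notin> \<rat>"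
  shows "0 \<le> cf_denom_shifted \<alpha> (Suc n) \<and> 1 \<le> cf_denom_shifted \<alpha> (Suc (Suc n))
    \<and> int n \<le> cf_denom_shifted \<alpha> (Suc (Suc n))"
proof -
  have a1: "1 \<le> cf_partial_quotient \<alpha> (Suc n)" for n
    using cf_complete_quotient_gt_1[OF assms, of n] unfolding cf_partial_quotient_def by linarith
  have "0 \<le> cf_denom_shifted \<alpha> (Suc n) \<and> 1 \<le> cf_denom_shifted \<alpha> (Suc (Suc n))
    \<and> int n \<le> cf_denom_shifted \<alpha> (Suc (Suc n))
    \<and> (n \<ge> 1 \<longrightarrow> 1 \<le> cf_denom_shifted \<alpha> (Suc n))"
  proof (induction n)
    case 0
    show ?case by simp
  next
    case (Suc n)
    have "cf_denom_shifted \<alpha> (Suc (Suc n))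
        \<le> cf_partial_quotient \<alpha> (Suc n) * cf_denom_shifted \<alpha> (Suc (Suc n))"
      using mult_right_mono[OF a1[of n], of "cf_denom_shifted \<alpha> (Suc (Suc n))"] Suc by linarith
    then have "cf_denom_shifted \<alpha> (Suc (Suc (Suc n)))
        \<ge> cf_denom_shifted \<alpha> (Suc (Suc n)) + cf_denom_shifted \<alpha> (Suc n)"
      by simp
    with Suc show ?case by (cases "n = 0") (auto simp del: cf_denom_shifted.simps(3))
  qed
  then show ?thesis by blast
qed

text \<open>
  Eliminating \<open>\<alpha>\<close> with the determinant identity gives
  \<open>\<bar>q\<^sub>n \<alpha> - p\<^sub>n\<bar> = 1 / (x\<^bsub>n+1\<^esub> q\<^sub>n + q\<^bsub>n-1\<^esub>)\<close>, which is at most \<open>1/q\<^sub>n\<close> because \<open>x\<^bsub>n+1\<^esub> > 1\<close>; the same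
  identity exhibits \<open>\<plusminus>q\<^bsub>n-1\<^esub>\<close> as an inverse of \<open>p\<^sub>n\<close> modulo \<open>q\<^sub>n\<close>.
\<close>

lemma approx_denom_cf_denom:
  assumes "\<alpha> \<notin> \<rat>"
  shows "approx_denom \<alpha> (cf_denom \<alpha> n)"
proof -
  define q where "q = cf_denom_shifted \<alpha> (Suc (Suc n))"
  define q' where "q' = cf_denom_shifted \<alpha> (Suc n)"
  define p where "p = snd (cf_num_pair \<alpha> (Suc n))"
  define p' where "p' = fst (cf_num_pair \<alpha> (Suc n))"
  define x where "x = cf_complete_quotient \<alpha> (Suc n)"
  define s where "s = (- 1 :: int) ^ n"
  have x: "1 < x" unfolding x_def by (rule cf_complete_quotient_gt_1[OF assms])
  have q: "1 \<le> q" "0 \<le> q'" using cf_denom_shifted_growth[OF assms, of n] by (auto simp: q_def q'_def)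
  have conv: "\<alpha> * (x * of_int q + of_int q') = x * of_int p + of_int p'"
    using cf_complete_quotient_convergents[OF assms, of "Suc n"]
    unfolding x_def q_def q'_def p_def p'_def .
  have det: "q * p' - q' * p = s"
    using cf_convergents_det[of \<alpha> "Suc n"] unfolding q_def q'_def p_def p'_def s_def by simp
  have s: "s * s = 1" "\<bar>real_of_int s\<bar> = 1"
    by (simp_all add: s_def power_mult_distrib[symmetric] power_abs)
  have "(- s * q') * p - 1 = - s * p' * q"
  proof -
    have "1 = s * (q * p' - q' * p)" using det s(1) by simp
    then show ?thesis by (simp add: algebra_simps)
  qed
  then have u: "q dvd (- s * q') * p - 1" by simp
  have d: "of_int q \<le> x * of_int q + of_int q'"
  proof -
    have "1 * real_of_int q \<le> x * of_int q" using x q by (intro mult_right_mono) auto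
    moreover have "0 \<le> real_of_int q'" using q by simp
    ultimately show ?thesis by linarith
  qed
  have "(of_int q * \<alpha> - of_int p) * (x * of_int q + of_int q') = of_int q * (\<alpha> * (x * of_int q + of_int q'))
      - of_int p * (x * of_int q + of_int q')" by algebra
  also have "\<dots> = of_int (q * p' - q' * p)" unfolding conv by (simp add: algebra_simps)
  finally have "\<bar>of_int q * \<alpha> - of_int p\<bar> * (x * of_int q + of_int q') = 1"
    using det s(2) d q by (metis abs_mult abs_of_nonneg of_int_0_le_iff order_trans zero_le_one)
  then have "\<bar>of_int q * \<alpha> - of_int p\<bar> = 1 / (x * of_int q + of_int q')"
    using d q by (simp add: field_simps)
  also have "\<dots> \<le> 1 / of_int q" using d q by (intro divide_left_mono mult_pos_pos) auto
  finally have b: "\<bar>of_int q * \<alpha> - of_int p\<bar> \<le> 1 / of_int q" .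
  have cf: "cf_denom \<alpha> n = nat q" by (simp add: cf_denom_def q_def del: cf_denom_shifted.simps)
  show ?thesis
    unfolding approx_denom_def cf
    by (intro conjI exI[of _ p] exI[of _ "- s * q'"]) (use q u b in simp_all)
qed

lemma cf_denom_ge:
  assumes "\<alpha> \<notin> \<rat>"
  shows "n \<le> cf_denom \<alpha> n"
  using cf_denom_shifted_growth[OF assms, of n] unfolding cf_denom_def
  by (simp add: le_nat_iff del: cf_denom_shifted.simps(3))

text \<open>
  Every integer is \<open>r = i p + m q\<close> with \<open>0 \<le> i < q\<close>, and then \<open>i \<alpha> + m - r/q = i (\<alpha> - p/q)\<close> is smaller
  than \<open>1/q\<close>. So the points \<open>i \<alpha>\<close> modulo \<open>1\<close> with \<open>i < q\<close> are distributed almost like the multiples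
  of \<open>1/q\<close>. Indexing by all integers \<open>r\<close>, rather than by residues, keeps the order of the line and
  avoids reasoning modulo \<open>1\<close>.
\<close>

lemma approx_denom_enumeration:
  assumes "approx_denom \<alpha> q"
  obtains i :: "int \<Rightarrow> nat" and m :: "int \<Rightarrow> int" where
    "\<And>s. bij_betw i {s..<s + int q} {..<q}"
    "\<And>r. i (r + int q) = i r" "\<And>r. m (r + int q) = m r + 1"
    "\<And>r. \<bar>real (i r) * \<alpha> + of_int (m r) - of_int r / real q\<bar> < 1 / real q"
proof -
  from assms obtain p u where q0: "0 < q" and u: "int q dvd u * p - 1"
    and appr: "\<bar>real q * \<alpha> - of_int p\<bar> \<le> 1 / real q"
    unfolding approx_denom_def by blast
  define i where "i r = nat ((r * u) mod int q)" for r :: int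
  define m where "m r = (r - ((r * u) mod int q) * p) div int q" for r :: int
  have ii: "int (i r) = (r * u) mod int q" for r using q0 by (simp add: i_def)
  have ilt: "i r < q" for r
    using q0 by (metis ii of_nat_less_iff of_nat_0_less_iff pos_mod_bound)
  have eq: "r = int (i r) * p + m r * int q" for r
  proof -
    have "r - ((r * u) mod int q) * p
      = r - (r * u - int q * ((r * u) div int q)) * p" by (simp add: minus_mult_div_eq_mod)
    also have "\<dots> = int q * (((r * u) div int q) * p) - r * (u * p - 1)"
      by (simp add: algebra_simps)
    finally have "int q dvd r - ((r * u) mod int q) * p" using u by (simp add: dvd_diff)
    then have "m r * int q = r - ((r * u) mod int q) * p" unfolding m_def by simp
    then show ?thesis by (simp add: ii)
  qed
  have per: "i (r + int q) = i r" for r by (simp add: i_def algebra_simps)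
  have perm: "m (r + int q) = m r + 1" for r
  proof -
    have "m (r + int q) * int q = (m r + 1) * int q"
      using eq[of r] eq[of "r + int q"] per[of r] by (simp add: algebra_simps)
    then show ?thesis using q0 by simp
  qed
  have bij: "bij_betw i {s..<s + int q} {..<q}" for s
  proof -
    have inj: "inj_on i {s..<s + int q}"
    proof (rule inj_onI)
      fix r r' assume r: "r \<in> {s..<s + int q}" "r' \<in> {s..<s + int q}" and "i r = i r'"
      then have d: "r - r' = (m r - m r') * int q"
        using eq[of r] eq[of r'] by (simp add: algebra_simps)
      moreover have "\<bar>r - r'\<bar> < int q" using r by auto
      ultimately have "\<bar>m r - m r'\<bar> * int q < 1 * int q" by (simp add: abs_mult)
      then have "\<bar>m r - m r'\<bar> < 1" using mult_less_cancel_right_pos[of "int q"] q0 by simp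
      with d show "r = r'" by simp
    qed
    have "i ` {s..<s + int q} = {..<q}"
      by (rule card_subset_eq) (use ilt inj in \<open>auto simp: card_image\<close>)
    with inj show ?thesis by (simp add: bij_betw_def)
  qed
  have "\<bar>real (i r) * \<alpha> + of_int (m r) - of_int r / real q\<bar> < 1 / real q" for r
  proof -
    have "real_of_int r = real (i r) * of_int p + of_int (m r) * real q"
      by (subst eq[of r]) simp
    then have "real (i r) * \<alpha> + of_int (m r) - of_int r / real q
        = real (i r) / real q * (real q * \<alpha> - of_int p)"
      using q0 by (simp add: field_simps)
    then have "\<bar>real (i r) * \<alpha> + of_int (m r) - of_int r / real q\<bar>
        = real (i r) / real q * \<bar>real q * \<alpha> - of_int p\<bar>" by (simp add: abs_mult)
    also have "\<dots> \<le> real (i r) / real q * (1 / real q)" using appr by (intro mult_left_mono) auto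
    also have "\<dots> < 1 * (1 / real q)"
      using ilt[of r] q0 by (intro mult_strict_right_mono) auto
    finally show ?thesis by simp
  qed
  with bij per perm show thesis using that by blast
qed

section \<open>Sums over quasiperiodic families of intervals\<close>

lemma sum_shift_quasiperiodic:
  fixes W :: "int \<Rightarrow> real"
  assumes "\<And>r. W (r + int q) = W r + V"
  shows "(\<Sum>r\<in>{0..<int q}. W (r + int K)) = (\<Sum>r\<in>{0..<int q}. W r) + real K * V"
proof (induction K)
  case 0
  then show ?case by simp
next
  case (Suc K)
  have "(\<Sum>r\<in>{0..<int q}. W (r + int (Suc K))) = (\<Sum>r\<in>{int K + 1..<int K + 1 + int q}. W r)"
    by (rule sum.reindex_bij_witness[of _ "\<lambda>r. r - int K - 1" "\<lambda>r. r + int K + 1"])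
      (auto simp: algebra_simps)
  also have "\<dots> = (\<Sum>r\<in>{int K..<int K + int q}. W r) + V"
  proof (cases "q = 0")
    case True
    then show ?thesis using assms[of 0] by simp
  next
    case False
    then have 1: "{int K + 1..<int K + 1 + int q} = insert (int K + int q) {int K + 1..<int K + int q}"
      and 2: "{int K..<int K + int q} = insert (int K) {int K + 1..<int K + int q}" by auto
    show ?thesis unfolding 1 2 using assms[of "int K"] by simp
  qed
  also have "(\<Sum>r\<in>{int K..<int K + int q}. W r) = (\<Sum>r\<in>{0..<int q}. W (r + int K))"
    by (rule sum.reindex_bij_witness[of _ "\<lambda>r. r + int K" "\<lambda>r. r - int K"]) auto
  finally show ?case using Suc by (simp add: algebra_simps)
qed

text \<open>
  A combinatorial form of bounded multiplicity. Since \<open>U (b r) \<le> U (a (r + K))\<close>, the sum is at most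
  the difference of a sum over a full period and the same sum shifted by \<open>K\<close>; each unit shift
  changes it by exactly \<open>V\<close>.
\<close>

lemma sum_increments_le:
  fixes U :: "real \<Rightarrow> real" and a b :: "int \<Rightarrow> real"
  assumes "mono U" "\<And>t. U (t + 1) = U t + V" "\<And>r. a (r + int q) = a r + 1"
    and "\<And>r. b r \<le> a (r + int K)"
  shows "(\<Sum>r\<in>{0..<int q}. U (b r) - U (a r)) \<le> real K * V"
proof -
  have "(\<Sum>r\<in>{0..<int q}. U (b r)) \<le> (\<Sum>r\<in>{0..<int q}. U (a (r + int K)))"
    using assms(1,4) by (intro sum_mono) (auto dest: monoD)
  also have "\<dots> = (\<Sum>r\<in>{0..<int q}. U (a r)) + real K * V"
    by (rule sum_shift_quasiperiodic) (simp add: assms)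
  finally show ?thesis by (simp add: sum_subtractf)
qed

lemma sum_increments_ge:
  fixes U :: "real \<Rightarrow> real" and a b :: "int \<Rightarrow> real"
  assumes "mono U" "\<And>t. U (t + 1) = U t + V" "\<And>r. a (r + int q) = a r + 1"
    and "\<And>r. a (r + 1) \<le> b r"
  shows "V \<le> (\<Sum>r\<in>{0..<int q}. U (b r) - U (a r))"
proof -
  have "(\<Sum>r\<in>{0..<int q}. U (a r)) + real 1 * V = (\<Sum>r\<in>{0..<int q}. U (a (r + int 1)))"
    by (rule sum_shift_quasiperiodic[symmetric]) (simp add: assms)
  also have "\<dots> \<le> (\<Sum>r\<in>{0..<int q}. U (b r))"
    using assms(1,4) by (intro sum_mono) (auto dest: monoD)
  finally show ?thesis by (simp add: sum_subtractf)
qed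

lemma quasiperiodic_int:
  fixes g :: "real \<Rightarrow> real"
  assumes "\<And>t. g (t + 1) = g t + c"
  shows "g (t + of_int m) = g t + of_int m * c"
proof -
  have nat: "g (t + real n) = g t + real n * c" for t n
  proof (induction n)
    case (Suc n)
    have "g (t + real (Suc n)) = g ((t + real n) + 1)" by (simp add: algebra_simps)
    then show ?case using assms[of "t + real n"] Suc by (simp add: algebra_simps)
  qed simp
  show ?thesis
  proof (cases m)
    case (nonneg n)
    then show ?thesis using nat by simp
  next
    case (neg n)
    then have m: "real_of_int m = - real (Suc n)" by simp
    show ?thesis using nat[of "t + of_int m" "Suc n"] unfolding m by (simp add: algebra_simps)
  qed
qed

section \<open>Monotone lifts and the order of orbits\<close>

locale degree_one_lift =
  fixes f :: "real \<Rightarrow> real" and \<alpha> :: real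
  assumes strict_mono_f: "strict_mono f"
    and f_plus_1: "f (t + 1) = f t + 1"
    and rotation: "(\<lambda>n. ((f ^^ n) t - t) / real n) \<longlonglongrightarrow> \<alpha>"
begin

lemma funpow_strict_mono: "strict_mono (f ^^ n)"
proof (induction n)
  case (Suc n)
  then show ?case using strict_mono_f by (auto simp: strict_mono_def)
qed (simp add: strict_mono_def)

lemma funpow_less: "s < t \<Longrightarrow> (f ^^ n) s < (f ^^ n) t"
  using funpow_strict_mono by (simp add: strict_mono_def)

lemma funpow_le: "s \<le> t \<Longrightarrow> (f ^^ n) s \<le> (f ^^ n) t"
  using funpow_strict_mono by (simp add: strict_mono_less_eq)

lemma funpow_plus_1: "(f ^^ n) (t + 1) = (f ^^ n) t + 1"
  by (induction n) (simp_all add: f_plus_1)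

lemma funpow_plus_int: "(f ^^ n) (t + of_int m) = (f ^^ n) t + of_int m"
  using quasiperiodic_int[of "f ^^ n" 1, OF funpow_plus_1] by simp

text \<open>
  The displacement of \<open>f ^^ n\<close> oscillates by at most \<open>1\<close>, so the displacement of its \<open>j\<close>-th iterate
  differs from \<open>j\<close> times that of \<open>f ^^ n\<close> at \<open>t\<close> by at most \<open>j\<close>. Dividing by \<open>j\<close> and letting
  \<open>j\<close> tend to infinity replaces the mean displacement by \<open>n \<alpha>\<close>.
\<close>

lemma displacement_bound: "\<bar>(f ^^ n) t - t - real n * \<alpha>\<bar> \<le> 1"
proof -
  define d where "d s = (f ^^ n) s - s" for s
  have osc: "\<bar>d s - d t\<bar> \<le> 1" for s
  proof -
    define k where "k = \<lfloor>s - t\<rfloor>"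
    have "t + of_int k \<le> s" "s \<le> t + of_int k + 1" unfolding k_def by linarith+
    moreover from this have "(f ^^ n) (t + of_int k) \<le> (f ^^ n) s"
      "(f ^^ n) s \<le> (f ^^ n) (t + of_int k + 1)" by (simp_all add: funpow_le)
    ultimately show ?thesis by (simp add: d_def funpow_plus_int funpow_plus_1 abs_le_iff)
  qed
  have tele: "\<bar>(f ^^ (n * j)) t - t - real j * d t\<bar> \<le> real j" for j
  proof (induction j)
    case (Suc j)
    have "(f ^^ (n * Suc j)) t = (f ^^ n) ((f ^^ (n * j)) t)"
      by (simp add: funpow_add)
    then have "(f ^^ (n * Suc j)) t = (f ^^ (n * j)) t + d ((f ^^ (n * j)) t)"
      by (simp add: d_def)
    then show ?case using Suc osc[of "(f ^^ (n * j)) t"] by (simp add: algebra_simps abs_le_iff)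
  qed simp
  show ?thesis
  proof (cases "n = 0")
    case False
    have lim: "(\<lambda>j. real n * (((f ^^ (n * Suc j)) t - t) / real (n * Suc j))) \<longlonglongrightarrow> real n * \<alpha>"
    proof (intro tendsto_mult tendsto_const)
      have "filterlim (\<lambda>j. n * Suc j) at_top sequentially"
        using False by (intro filterlim_subseq) (simp add: strict_mono_Suc_iff)
      from filterlim_compose[OF rotation this]
      show "(\<lambda>j. ((f ^^ (n * Suc j)) t - t) / real (n * Suc j)) \<longlonglongrightarrow> \<alpha>" .
    qed
    have "\<bar>real n * (((f ^^ (n * Suc j)) t - t) / real (n * Suc j)) - d t\<bar> \<le> 1" for j
    proof -
      have "real n * (((f ^^ (n * Suc j)) t - t) / real (n * Suc j)) - d t
        = ((f ^^ (n * Suc j)) t - t - real (Suc j) * d t) / real (Suc j)"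
      proof -
        have "u * (A / (u * v)) - d = (A - v * d) / v" if "u > 0" "v > 0" for u v A d :: real
          using that by (simp add: field_simps)
        from this[of "real n" "real (Suc j)"] show ?thesis
          using False by (simp del: of_nat_Suc mult_Suc_right)
      qed
      also have "\<bar>\<dots>\<bar> \<le> real (Suc j) / real (Suc j)"
        unfolding abs_divide abs_of_nat by (intro divide_right_mono tele) simp
      finally show ?thesis by simp
    qed
    then have "\<bar>real n * \<alpha> - d t\<bar> \<le> 1"
      by (intro LIMSEQ_le_const2[OF tendsto_rabs[OF tendsto_diff[OF lim tendsto_const]]]) auto
    then show ?thesis by (simp add: d_def abs_minus_commute algebra_simps)
  qed simp
qed

text \<open>
  A monotone map that conjugates \<open>f\<close> to the translation by \<open>\<alpha>\<close>. Neither continuity nor strictness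
  is built in; strictness is derived below for smooth \<open>f\<close>, and continuity is avoided by comparing
  points only through the implication from \<open>H s < H t\<close> to \<open>s < t\<close>.
\<close>

definition H :: "real \<Rightarrow> real"
  where "H t = real_of_ereal (limsup (\<lambda>n. ereal ((f ^^ n) t - real n * \<alpha>)))"

lemma ereal_H: "ereal (H t) = limsup (\<lambda>n. ereal ((f ^^ n) t - real n * \<alpha>))"
proof -
  have b: "(f ^^ n) t - real n * \<alpha> \<le> t + 1" "t - 1 \<le> (f ^^ n) t - real n * \<alpha>" for n
    using displacement_bound[of n t] by (simp_all add: abs_le_iff)
  have "limsup (\<lambda>n. ereal ((f ^^ n) t - real n * \<alpha>)) \<le> ereal (t + 1)"
    by (rule Limsup_bounded) (use b in auto)
  moreover have "ereal (t - 1) \<le> limsup (\<lambda>n. ereal ((f ^^ n) t - real n * \<alpha>))"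
    by (rule le_Limsup) (use b in auto)
  ultimately have "\<bar>limsup (\<lambda>n. ereal ((f ^^ n) t - real n * \<alpha>))\<bar> \<noteq> \<infinity>" by auto
  then show ?thesis by (simp add: H_def ereal_real')
qed

lemma H_add:
  assumes "\<And>n. (f ^^ n) s - real n * \<alpha> = (f ^^ n) t - real n * \<alpha> + c"
  shows "H s = H t + c"
proof -
  have "ereal (H s) = limsup (\<lambda>n. ereal ((f ^^ n) t - real n * \<alpha>) + ereal c)"
    unfolding ereal_H assms by simp
  also have "\<dots> = limsup (\<lambda>n. ereal ((f ^^ n) t - real n * \<alpha>)) + ereal c"
    by (rule Limsup_add_ereal_right) auto
  also have "\<dots> = ereal (H t + c)" unfolding ereal_H[symmetric] by simp
  finally show ?thesis by simp
qed

lemma H_plus_int: "H (t + of_int m) = H t + of_int m"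
  by (rule H_add) (simp add: funpow_plus_int)

lemma H_mono: "s \<le> t \<Longrightarrow> H s \<le> H t"
proof -
  assume "s \<le> t"
  then have "ereal (H s) \<le> ereal (H t)"
    unfolding ereal_H by (intro Limsup_mono) (simp add: funpow_le)
  then show ?thesis by simp
qed

lemma less_if_H_less: "H s < H t \<Longrightarrow> s < t"
  using H_mono[of t s] by linarith

lemma H_f: "H (f t) = H t + \<alpha>"
proof -
  have e: "(f ^^ n) (f t) - real n * \<alpha> = ((f ^^ Suc n) t - real (Suc n) * \<alpha>) + \<alpha>" for n
    using funpow_swap1[of f n t] by (simp add: algebra_simps)
  have "ereal (H (f t)) = limsup (\<lambda>n. ereal ((f ^^ (Suc n)) t - real (Suc n) * \<alpha>) + ereal \<alpha>)"
    unfolding ereal_H e by (simp only: plus_ereal.simps)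
  also have "\<dots> = limsup (\<lambda>n. ereal ((f ^^ (Suc n)) t - real (Suc n) * \<alpha>)) + ereal \<alpha>"
    by (rule Limsup_add_ereal_right) auto
  also have "limsup (\<lambda>n. ereal ((f ^^ (Suc n)) t - real (Suc n) * \<alpha>)) = ereal (H t)"
    using limsup_shift[of "\<lambda>n. ereal ((f ^^ n) t - real n * \<alpha>)"] by (simp only: ereal_H Suc_eq_plus1)
  finally show ?thesis by simp
qed

lemma H_funpow: "H ((f ^^ n) t) = H t + real n * \<alpha>"
  by (induction n) (simp_all add: H_f algebra_simps)

text \<open>
  The orbit segment of length \<open>q\<close>, translated by integers and reordered: the point with index \<open>r\<close> has
  \<open>H\<close>-coordinate within \<open>1/q\<close> of \<open>H t + r/q\<close>. In particular points whose indices differ by at least \<open>2\<close>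
  are in the expected order.
\<close>

lemma ordered_orbit:
  assumes "approx_denom \<alpha> q"
  obtains i :: "int \<Rightarrow> nat" and m :: "int \<Rightarrow> int" where
    "\<And>G s. (\<Sum>r\<in>{s..<s + int q}. G (i r)) = (\<Sum>j<q. G j :: real)"
    "\<And>r t. (f ^^ i (r + int q)) t + of_int (m (r + int q)) = (f ^^ i r) t + of_int (m r) + 1"
    "\<And>r t. H t + of_int (r - 1) / real q < H ((f ^^ i r) t + of_int (m r))"
    "\<And>r t. H ((f ^^ i r) t + of_int (m r)) < H t + of_int (r + 1) / real q"
proof -
  obtain i m where im: "\<And>s. bij_betw i {s..<s + int q} {..<q}"
    "\<And>r. i (r + int q) = i r" "\<And>r. m (r + int q) = m r + 1"
    and b: "\<And>r. \<bar>real (i r) * \<alpha> + of_int (m r) - of_int r / real q\<bar> < 1 / real q"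
    by (rule approx_denom_enumeration[OF assms]) (rule that, assumption+)
  have lo: "H t + of_int (r - 1) / real q < H ((f ^^ i r) t + of_int (m r))" for r t
    using b[of r] by (simp add: H_plus_int H_funpow diff_divide_distrib abs_less_iff)
  have hi: "H ((f ^^ i r) t + of_int (m r)) < H t + of_int (r + 1) / real q" for r t
    using b[of r] by (simp add: H_plus_int H_funpow add_divide_distrib abs_less_iff)
  show ?thesis
  proof (rule that[of i m])
    show "(\<Sum>r\<in>{s..<s + int q}. G (i r)) = (\<Sum>j<q. G j :: real)" for G s
      by (rule sum.reindex_bij_betw[OF im(1)])
    show "(f ^^ i (r + int q)) t + of_int (m (r + int q)) = (f ^^ i r) t + of_int (m r) + 1" for r t
      by (simp add: im(2,3))
  qed (rule lo hi)+
qed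

section \<open>The Denjoy--Koksma inequality and overlaps of iterated intervals\<close>

definition birkhoff :: "nat \<Rightarrow> (real \<Rightarrow> real) \<Rightarrow> real \<Rightarrow> real"
  where "birkhoff n \<phi> t = (\<Sum>j<n. \<phi> ((f ^^ j) t))"

text \<open>
  The Denjoy--Koksma inequality, for a function whose variation is dominated by \<open>U\<close> with \<open>V\<close> the
  variation over one period. The orbits of \<open>x\<close> and \<open>y\<close> are paired so that corresponding points are
  at most a few multiples of \<open>1/q\<close> apart in the \<open>H\<close>-coordinate; the intervals between them have
  multiplicity at most \<open>5\<close>. Comparing two orbits, instead of one orbit with a space average,
  requires no relation between \<open>H\<close> and an invariant measure.
\<close>

lemma denjoy_koksma:
  assumes q: "approx_denom \<alpha> q"
    and U: "mono U" "\<And>t. U (t + 1) = U t + V"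
    and \<phi>: "\<And>t. \<phi> (t + 1) = \<phi> t" "\<And>s t. s \<le> t \<Longrightarrow> \<bar>\<phi> s - \<phi> t\<bar> \<le> U t - U s"
  shows "\<bar>birkhoff q \<phi> x - birkhoff q \<phi> y\<bar> \<le> 5 * V"
proof -
  obtain i m where
    re: "\<And>G s. (\<Sum>r\<in>{s..<s + int q}. G (i r)) = (\<Sum>j<q. G j :: real)" and
    per: "\<And>r t. (f ^^ i (r + int q)) t + of_int (m (r + int q)) = (f ^^ i r) t + of_int (m r) + 1" and
    lo: "\<And>r t. H t + of_int (r - 1) / real q < H ((f ^^ i r) t + of_int (m r))" and
    hi: "\<And>r t. H ((f ^^ i r) t + of_int (m r)) < H t + of_int (r + 1) / real q"
    by (rule ordered_orbit[OF q]) (rule that, assumption+)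
  have q0: "0 < q" using q by (simp add: approx_denom_def)
  \<comment> \<open>Shifting the orbit of \<open>y\<close> by \<open>s\<close> aligns it with that of \<open>x\<close> up to \<open>1/q\<close>; two more steps put each
     of its points to the right of its partner.\<close>
  define s where "s = \<lceil>real q * (H x - H y)\<rceil>"
  have "real q * (H x - H y) \<le> of_int s" "of_int s \<le> real q * (H x - H y) + 1"
    by (simp_all add: s_def)
  then have s: "H x \<le> H y + of_int s / real q" "H y + of_int s / real q \<le> H x + 1 / real q"
    using divide_right_mono[of "real q * (H x - H y)" "of_int s" "real q"]
      divide_right_mono[of "of_int s" "real q * (H x - H y) + 1" "real q"] q0
    by (simp_all add: add_divide_distrib)
  define a where "a r = (f ^^ i r) x + of_int (m r)" for r
  define b where "b r = (f ^^ i (r + (s + 2))) y + of_int (m (r + (s + 2)))" for r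
  have a1: "H x + of_int (r - 1) / real q < H (a r)" "H (a r) < H x + of_int (r + 1) / real q" for r
    unfolding a_def by (rule lo hi)+
  have b1: "H y + of_int (r + (s + 2) - 1) / real q < H (b r)"
    "H (b r) < H y + of_int (r + (s + 2) + 1) / real q" for r
    unfolding b_def by (rule lo hi)+
  have ab: "a r \<le> b r" for r
  proof -
    have "of_int (r + (s + 2) - 1) / real q = of_int (r + 1) / real q + of_int s / real q"
      by (simp add: add_divide_distrib[symmetric])
    then show ?thesis using a1(2)[of r] b1(1)[of r] s(1)
      by - (rule less_imp_le[OF less_if_H_less], linarith)
  qed
  have ba: "b r \<le> a (r + int 5)" for r
  proof -
    have "of_int (r + (s + 2) + 1) / real q + 1 / real q
        = of_int (r + int 5 - 1) / real q + of_int s / real q"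
      by (simp add: add_divide_distrib[symmetric])
    then show ?thesis using a1(1)[of "r + int 5"] b1(2)[of r] s(2)
      by - (rule less_imp_le[OF less_if_H_less], linarith)
  qed
  have \<phi>int: "\<phi> (t + of_int k) = \<phi> t" for t k
    using quasiperiodic_int[of \<phi> 0] \<phi>(1) by simp
  have "birkhoff q \<phi> x = (\<Sum>r\<in>{0..<int q}. \<phi> (a r))"
    using re[of "\<lambda>j. \<phi> ((f ^^ j) x)" 0] by (simp add: birkhoff_def a_def \<phi>int)
  moreover have "birkhoff q \<phi> y = (\<Sum>r\<in>{0..<int q}. \<phi> (b r))"
  proof -
    have "birkhoff q \<phi> y = (\<Sum>r\<in>{s + 2..<s + 2 + int q}. \<phi> ((f ^^ i r) y + of_int (m r)))"
      using re[of "\<lambda>j. \<phi> ((f ^^ j) y)" "s + 2"] by (simp add: birkhoff_def \<phi>int)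
    also have "\<dots> = (\<Sum>r\<in>{0..<int q}. \<phi> (b r))"
      by (rule sum.reindex_bij_witness[of _ "\<lambda>r. r + (s + 2)" "\<lambda>r. r - (s + 2)"])
        (auto simp: b_def)
    finally show ?thesis .
  qed
  ultimately have "\<bar>birkhoff q \<phi> x - birkhoff q \<phi> y\<bar> \<le> (\<Sum>r\<in>{0..<int q}. \<bar>\<phi> (a r) - \<phi> (b r)\<bar>)"
    by (simp add: sum_subtractf[symmetric] sum_abs)
  also have "\<dots> \<le> (\<Sum>r\<in>{0..<int q}. U (b r) - U (a r))"
    using ab by (intro sum_mono \<phi>(2))
  also have "\<dots> \<le> real 5 * V"
    by (rule sum_increments_le[OF U, of a q b 5]) (use per ba in \<open>auto simp: a_def\<close>)
  finally show ?thesis by simp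
qed

text \<open>
  The images \<open>[f\<^sup>j x, f\<^sup>j y]\<close> of an interval of \<open>H\<close>-length at most \<open>k/q\<close> overlap boundedly on the circle.
  The function \<open>U\<close> is the identity when lengths are summed, a primitive when integrals are.
\<close>

lemma overlap_bound:
  assumes q: "approx_denom \<alpha> q"
    and U: "mono U" "\<And>t. U (t + 1) = U t + V"
    and xy: "H y \<le> H x + real k / real q"
  shows "(\<Sum>j<q. U ((f ^^ j) y) - U ((f ^^ j) x)) \<le> real (k + 2) * V"
proof -
  obtain i m where
    re: "\<And>G s. (\<Sum>r\<in>{s..<s + int q}. G (i r)) = (\<Sum>j<q. G j :: real)" and
    per: "\<And>r t. (f ^^ i (r + int q)) t + of_int (m (r + int q)) = (f ^^ i r) t + of_int (m r) + 1" and
    lo: "\<And>r t. H t + of_int (r - 1) / real q < H ((f ^^ i r) t + of_int (m r))" and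
    hi: "\<And>r t. H ((f ^^ i r) t + of_int (m r)) < H t + of_int (r + 1) / real q"
    by (rule ordered_orbit[OF q]) (rule that, assumption+)
  define a where "a r = (f ^^ i r) x + of_int (m r)" for r
  define b where "b r = (f ^^ i r) y + of_int (m r)" for r
  have ba: "b r \<le> a (r + int (k + 2))" for r
  proof -
    have "of_int (r + int (k + 2) - 1) / real q = of_int (r + 1) / real q + real k / real q"
      by (simp add: add_divide_distrib[symmetric])
    then show ?thesis using lo[of x "r + int (k + 2)"] hi[of r y] xy unfolding a_def b_def
      by - (rule less_imp_le[OF less_if_H_less], linarith)
  qed
  have "(\<Sum>j<q. U ((f ^^ j) y) - U ((f ^^ j) x)) = (\<Sum>r\<in>{0..<int q}. U (b r) - U (a r))"
    using re[of "\<lambda>j. U ((f ^^ j) y) - U ((f ^^ j) x)" 0] quasiperiodic_int[of U V, OF U(2)]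
    by (simp add: a_def b_def)
  also have "\<dots> \<le> real (k + 2) * V"
    by (rule sum_increments_le[OF U]) (use per ba in \<open>auto simp: a_def\<close>)
  finally show ?thesis .
qed

lemma cover_bound:
  fixes U :: "real \<Rightarrow> real"
  assumes q: "approx_denom \<alpha> q"
    and U: "mono U" "\<And>t. U (t + 1) = U t + V"
    and xy: "H x + 3 / real q < H y"
  shows "V \<le> (\<Sum>j<q. U ((f ^^ j) y) - U ((f ^^ j) x))"
proof -
  obtain i m where
    re: "\<And>G s. (\<Sum>r\<in>{s..<s + int q}. G (i r)) = (\<Sum>j<q. G j :: real)" and
    per: "\<And>r t. (f ^^ i (r + int q)) t + of_int (m (r + int q)) = (f ^^ i r) t + of_int (m r) + 1" and
    lo: "\<And>r t. H t + of_int (r - 1) / real q < H ((f ^^ i r) t + of_int (m r))" and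
    hi: "\<And>r t. H ((f ^^ i r) t + of_int (m r)) < H t + of_int (r + 1) / real q"
    by (rule ordered_orbit[OF q]) (rule that, assumption+)
  define a where "a r = (f ^^ i r) x + of_int (m r)" for r
  define b where "b r = (f ^^ i r) y + of_int (m r)" for r
  have ab: "a (r + 1) \<le> b r" for r
  proof -
    have "of_int (r + 1 + 1) / real q = of_int (r - 1) / real q + 3 / real q"
      by (simp add: add_divide_distrib[symmetric])
    then show ?thesis using lo[of y r] hi[of "r + 1" x] xy unfolding a_def b_def
      by - (rule less_imp_le[OF less_if_H_less], linarith)
  qed
  have "V \<le> (\<Sum>r\<in>{0..<int q}. U (b r) - U (a r))"
    by (rule sum_increments_ge[OF U]) (use per ab in \<open>auto simp: a_def\<close>)
  also have "\<dots> = (\<Sum>j<q. U ((f ^^ j) y) - U ((f ^^ j) x))"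
    using re[of "\<lambda>j. U ((f ^^ j) y) - U ((f ^^ j) x)" 0] quasiperiodic_int[of U V, OF U(2)]
    by (simp add: a_def b_def)
  finally show ?thesis .
qed

text \<open>
  An interval starting at \<open>x\<close> whose first \<open>q\<close> images cover the circle (by \<open>cover_bound\<close>, as the
  \<open>H\<close>-length exceeds \<open>3/q\<close>) and overlap boundedly (by \<open>overlap_bound\<close>, as it is below \<open>5/q\<close>). The
  endpoint is the point of index \<open>4\<close> in the ordered orbit of \<open>x\<close>; its \<open>H\<close>-coordinate is known
  although \<open>H\<close> need not be onto.
\<close>

lemma window:
  assumes q: "approx_denom \<alpha> q"
  obtains y where "x < y" "H x + 3 / real q < H y" "H y < H x + 5 / real q"
proof -
  obtain i m where
    "\<And>G s. (\<Sum>r\<in>{s..<s + int q}. G (i r)) = (\<Sum>j<q. G j :: real)" and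
    "\<And>r t. (f ^^ i (r + int q)) t + of_int (m (r + int q)) = (f ^^ i r) t + of_int (m r) + 1" and
    lo: "\<And>r t. H t + of_int (r - 1) / real q < H ((f ^^ i r) t + of_int (m r))" and
    hi: "\<And>r t. H ((f ^^ i r) t + of_int (m r)) < H t + of_int (r + 1) / real q"
    by (rule ordered_orbit[OF q]) (rule that, assumption+)
  define y where "y = (f ^^ i 4) x + of_int (m 4)"
  have y: "H x + 3 / real q < H y" "H y < H x + 5 / real q"
    using lo[of x 4] hi[of 4 x] by (simp_all add: y_def)
  have "0 < 3 / real q" using q by (simp add: approx_denom_def)
  then have "x < y" using y(1) by - (rule less_if_H_less, linarith)
  with y show ?thesis using that by blast
qed

end

section \<open>Denjoy theory of smooth lifts\<close>

lemma periodic_uniformly_continuous: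
  fixes g :: "real \<Rightarrow> real"
  assumes "continuous_on UNIV g" "\<And>t. g (t + 1) = g t" "0 < \<epsilon>"
  obtains \<eta> where "0 < \<eta>" "\<And>s t. \<bar>s - t\<bar> < \<eta> \<Longrightarrow> \<bar>g s - g t\<bar> < \<epsilon>"
proof -
  have "uniformly_continuous_on {-1..2} g"
    by (rule compact_uniformly_continuous) (auto intro: continuous_on_subset[OF assms(1)])
  then obtain d where d: "0 < d" "\<And>s t. s \<in> {-1..2} \<Longrightarrow> t \<in> {-1..2} \<Longrightarrow> dist t s < d \<Longrightarrow> dist (g t) (g s) < \<epsilon>"
    using assms(3) unfolding uniformly_continuous_on_def by metis
  have "\<bar>g s - g t\<bar> < \<epsilon>" if "\<bar>s - t\<bar> < min d 1" for s t
  proof -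
    define k where "k = - \<lfloor>t\<rfloor>"
    have shift: "g (r + of_int k) = g r" for r
      using quasiperiodic_int[of g 0] assms(2) by simp
    have k: "0 \<le> t + of_int k" "t + of_int k \<le> 1" unfolding k_def by linarith+
    have "dist (g (s + of_int k)) (g (t + of_int k)) < \<epsilon>"
      using that k by (intro d(2)) (auto simp: dist_real_def)
    then show ?thesis by (simp add: shift dist_real_def)
  qed
  then show ?thesis using that[of "min d 1"] d(1) by simp
qed

lemma derivative_periodic:
  fixes \<phi> :: "real \<Rightarrow> real"
  assumes "\<And>t. (\<phi> has_real_derivative h t) (at t)" "\<And>t. \<phi> (t + 1) = \<phi> t + c"
  shows "h (t + 1) = h t"
proof -
  have "((\<lambda>s. \<phi> (s + 1)) has_real_derivative h (t + 1)) (at t)"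
    using assms(1)[of "t + 1"] unfolding DERIV_shift .
  moreover have "((\<lambda>s. \<phi> s + c) has_real_derivative h t + 0) (at t)"
    by (intro DERIV_add assms(1) DERIV_const)
  ultimately show ?thesis using DERIV_unique by (fastforce simp: assms(2))
qed

text \<open>
  Second derivatives enter only through the Lipschitz constant \<open>M\<close> of \<open>ln f'\<close>. The
  sequence \<open>Q\<close> plays the role of the denominators \<open>q\<^sub>n\<close>.
\<close>

locale smooth_lift = degree_one_lift +
  fixes f' :: "real \<Rightarrow> real" and M :: real and Q :: "nat \<Rightarrow> nat"
  assumes DERIV_f: "(f has_real_derivative f' t) (at t)"
    and f'_pos: "0 < f' t"
    and f'_cont: "continuous_on UNIV f'"
    and ln_f'_lipschitz: "\<bar>ln (f' s) - ln (f' t)\<bar> \<le> M * \<bar>s - t\<bar>"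
    and Q_approx: "approx_denom \<alpha> (Q n)"
    and Q_at_top: "filterlim Q at_top sequentially"
begin

lemma M_nonneg: "0 \<le> M"
  using ln_f'_lipschitz[of 1 0] by simp

lemma f'_periodic: "f' (t + 1) = f' t"
  by (rule derivative_periodic[OF DERIV_f f_plus_1])

definition Df :: "nat \<Rightarrow> real \<Rightarrow> real"
  where "Df n t = (\<Prod>j<n. f' ((f ^^ j) t))"

lemma Df_pos: "0 < Df n t"
  unfolding Df_def by (intro prod_pos) (simp add: f'_pos)

lemma DERIV_funpow: "((f ^^ n) has_real_derivative Df n t) (at t)"
proof (induction n)
  case 0
  show ?case by (simp add: Df_def id_def)
next
  case (Suc n)
  have "((\<lambda>s. f ((f ^^ n) s)) has_real_derivative f' ((f ^^ n) t) * Df n t) (at t)"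
    by (rule DERIV_chain2[OF DERIV_f Suc])
  then show ?case by (simp add: Df_def o_def mult.commute)
qed

lemma funpow_cont: "continuous_on UNIV (f ^^ n)"
  by (meson DERIV_funpow DERIV_isCont continuous_at_imp_continuous_on)

lemma compose_funpow_cont: "continuous_on UNIV g \<Longrightarrow> continuous_on UNIV (\<lambda>t. g ((f ^^ n) t))"
  using continuous_on_compose2[OF _ funpow_cont, of UNIV g n] by simp

lemma Df_cont: "continuous_on UNIV (Df n)"
  unfolding Df_def by (intro continuous_on_prod compose_funpow_cont f'_cont)

lemma ln_Df: "ln (Df n t) = birkhoff n (\<lambda>s. ln (f' s)) t"
  unfolding Df_def birkhoff_def by (rule ln_prod) (simp_all add: f'_pos less_imp_neq[OF f'_pos, symmetric])

lemma mono_scale_M: "mono (\<lambda>t. M * t)"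
  using M_nonneg by (auto intro: monoI mult_left_mono)

text \<open>
  Denjoy's estimate: by the Denjoy--Koksma inequality \<open>ln (f\<^sup>q)'\<close> varies by at most \<open>5 M\<close>, and it
  vanishes somewhere because \<open>f\<^sup>q\<close> maps a unit interval to a unit interval.
\<close>

lemma Df_return_bound:
  assumes "approx_denom \<alpha> q"
  shows "exp (- 5 * M) \<le> Df q x"
proof -
  obtain z where "(f ^^ q) 1 - (f ^^ q) 0 = (1 - 0) * Df q z"
    using MVT2[of 0 1 "f ^^ q" "Df q"] DERIV_funpow by auto
  then have z: "Df q z = 1" using funpow_plus_1[of q 0] by simp
  have "\<bar>birkhoff q (\<lambda>s. ln (f' s)) z - birkhoff q (\<lambda>s. ln (f' s)) x\<bar> \<le> 5 * M"
  proof (rule denjoy_koksma[OF assms mono_scale_M])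
    show "\<bar>ln (f' s) - ln (f' t)\<bar> \<le> M * t - M * s" if "s \<le> t" for s t
      using ln_f'_lipschitz[of s t] that by (simp add: algebra_simps)
  qed (simp_all add: algebra_simps f'_periodic)
  then have "- 5 * M \<le> ln (Df q x)" using z by (simp add: ln_Df[symmetric])
  then show ?thesis using Df_pos ln_ge_iff by blast
qed

text \<open>
  Denjoy's theorem. If \<open>H s = H t\<close>, the iterates of \<open>[s, t]\<close> have bounded multiplicity on the
  circle, so their lengths are summable; but at every time \<open>Q n\<close> the length is at least
  \<open>exp (- 5 M) (t - s)\<close>.
\<close>

lemma H_strict_mono: "s < t \<Longrightarrow> H s < H t"
proof (rule ccontr)
  assume "s < t" "\<not> H s < H t"
  then have H: "H t \<le> H s + real 0 / real q" for q by simp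
  define c where "c j = (f ^^ j) t - (f ^^ j) s" for j
  have c0: "0 \<le> c j" for j using \<open>s < t\<close> by (simp add: c_def funpow_le)
  have sum_Q: "(\<Sum>j<Q n. c j) \<le> 2" for n
  proof -
    have "(\<Sum>j<Q n. (f ^^ j) t - (f ^^ j) s) \<le> real (0 + 2) * 1"
      by (rule overlap_bound[OF Q_approx, where U = "\<lambda>t. t", OF _ _ H]) (simp_all add: mono_def)
    then show ?thesis by (simp add: c_def)
  qed
  have "(\<Sum>j<k. c j) \<le> 2" for k
  proof -
    from Q_at_top have "eventually (\<lambda>n. k \<le> Q n) sequentially" by (simp add: filterlim_at_top)
    then obtain n where "k \<le> Q n" by (auto simp: eventually_sequentially)
    then have "(\<Sum>j<k. c j) \<le> (\<Sum>j<Q n. c j)" using c0 by (intro sum_mono2) auto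
    with sum_Q[of n] show ?thesis by linarith
  qed
  then have "summable c" using c0 by (intro summableI_nonneg_bounded[of c 2])
  then have "c \<longlonglongrightarrow> 0" by (rule summable_LIMSEQ_zero)
  then have lim: "(\<lambda>n. c (Q n)) \<longlonglongrightarrow> 0" by (rule filterlim_compose[OF _ Q_at_top])
  have "exp (- 5 * M) * (t - s) \<le> c (Q n)" for n
  proof -
    obtain z where z: "(f ^^ Q n) t - (f ^^ Q n) s = (t - s) * Df (Q n) z"
      using MVT2[of s t "f ^^ Q n" "Df (Q n)"] DERIV_funpow \<open>s < t\<close> by auto
    have "exp (- 5 * M) * (t - s) \<le> Df (Q n) z * (t - s)"
      using \<open>s < t\<close> by (intro mult_right_mono Df_return_bound Q_approx) simp
    then show ?thesis unfolding c_def z by (simp only: mult.commute)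
  qed
  then have "exp (- 5 * M) * (t - s) \<le> 0"
    using LIMSEQ_le_const[OF lim] by blast
  moreover have "0 < exp (- 5 * M) * (t - s)" using \<open>s < t\<close> by simp
  ultimately show False by linarith
qed

text \<open>
  A strictly increasing \<open>H\<close> with \<open>H (t + 1) = H t + 1\<close> has increments bounded below on the cells of
  a fine grid; an interval of length \<open>\<epsilon>\<close> contains such a cell. This replaces the uniform
  continuity of the inverse of \<open>H\<close>.
\<close>

lemma H_mesh:
  assumes "0 < \<epsilon>"
  obtains \<eta> where "0 < \<eta>" "\<And>s t. H t - H s < \<eta> \<Longrightarrow> t - s < \<epsilon>"
proof -
  obtain N :: nat where N: "2 / \<epsilon> < real N" using reals_Archimedean2 by blast
  then have N0: "0 < real N" using assms by (meson divide_pos_pos less_trans zero_less_numeral)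
  define D where "D j = H (of_int (j + 1) / real N) - H (of_int j / real N)" for j :: int
  define \<eta> where "\<eta> = Min (D ` {0..<int N})"
  have Dpos: "0 < D j" for j
    unfolding D_def using N0 by (simp add: H_strict_mono divide_strict_right_mono)
  have ne: "{0..<int N} \<noteq> {}" using N0 by auto
  have "0 < \<eta>" unfolding \<eta>_def using ne Dpos by (subst Min_gr_iff) auto
  have \<eta>: "\<eta> \<le> D j" for j
  proof -
    have "D j = D (j mod int N)"
    proof -
      have j: "real_of_int j = of_int (j mod int N) + real N * of_int (j div int N)"
        by (metis add.commute mult_div_mod_eq of_int_add of_int_mult of_int_of_nat_eq)
      have "of_int j / real N = of_int (j mod int N) / real N + of_int (j div int N)"
        "of_int (j + 1) / real N = of_int (j mod int N + 1) / real N + of_int (j div int N)"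
        using N0 j by (simp_all add: field_simps)
      then show ?thesis unfolding D_def by (simp only: H_plus_int)
    qed
    also have "\<eta> \<le> \<dots>" unfolding \<eta>_def using N0 by (intro Min_le) auto
    finally show ?thesis .
  qed
  have "t - s < \<epsilon>" if "H t - H s < \<eta>" for s t
  proof (rule ccontr)
    assume "\<not> t - s < \<epsilon>"
    moreover have "2 / real N < \<epsilon>" using N assms N0 by (simp add: field_simps)
    ultimately have "s + 2 / real N \<le> t" by linarith
    define k where "k = \<lceil>s * real N\<rceil>"
    have "s * real N \<le> of_int k" "of_int k \<le> s * real N + 1" unfolding k_def by linarith+
    then have "s * real N / real N \<le> of_int k / real N"
      "of_int (k + 1) / real N \<le> (s * real N + 2) / real N"
      using N0 by (intro divide_right_mono; simp)+
    then have "s \<le> of_int k / real N" "of_int (k + 1) / real N \<le> s + 2 / real N"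
      using N0 by (simp_all add: add_divide_distrib)
    then have "H s \<le> H (of_int k / real N)" "H (of_int (k + 1) / real N) \<le> H t"
      using \<open>s + 2 / real N \<le> t\<close> by (auto intro!: H_mono)
    with \<eta>[of k] that show False unfolding D_def by linarith
  qed
  with \<open>0 < \<eta>\<close> show ?thesis using that by blast
qed

lemma eventually_Q_large: "0 < \<eta> \<Longrightarrow> eventually (\<lambda>n. c / real (Q n) < \<eta>) sequentially"
proof -
  assume "0 < \<eta>"
  have "(\<lambda>n. c / real (Q n)) \<longlonglongrightarrow> 0"
    by (rule real_tendsto_divide_at_top[OF tendsto_const])
      (rule filterlim_compose[OF filterlim_real_sequentially Q_at_top])
  then show ?thesis using \<open>0 < \<eta>\<close> by (rule order_tendstoD)
qed

text \<open>
  Since \<open>f\<^sup>q - p\<close> moves the \<open>H\<close>-coordinate by \<open>q \<alpha> - p\<close>, the return maps \<open>f ^^ Q n\<close> converge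
  uniformly to the identity of the circle. Hence the Birkhoff sums of a coboundary \<open>\<psi> \<circ> f - \<psi>\<close>
  along \<open>Q n\<close> tend to \<open>0\<close>.
\<close>

lemma eventually_return_close:
  fixes \<psi> :: "real \<Rightarrow> real"
  assumes "continuous_on UNIV \<psi>" "\<And>t. \<psi> (t + 1) = \<psi> t" "0 < \<epsilon>"
  shows "eventually (\<lambda>n. \<forall>t. \<bar>\<psi> ((f ^^ Q n) t) - \<psi> t\<bar> < \<epsilon>) sequentially"
proof -
  obtain \<eta> where \<eta>: "0 < \<eta>" "\<And>s t. \<bar>s - t\<bar> < \<eta> \<Longrightarrow> \<bar>\<psi> s - \<psi> t\<bar> < \<epsilon>"
    using periodic_uniformly_continuous[OF assms] by metis
  obtain \<delta> where \<delta>: "0 < \<delta>" "\<And>s t. H t - H s < \<delta> \<Longrightarrow> t - s < \<eta>"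
    using H_mesh[OF \<eta>(1)] by metis
  from eventually_Q_large[OF \<delta>(1), of 1] show ?thesis
  proof eventually_elim
    case (elim n)
    obtain p where p: "\<bar>real (Q n) * \<alpha> - of_int p\<bar> \<le> 1 / real (Q n)"
      using Q_approx[of n] unfolding approx_denom_def by blast
    show ?case
    proof
      fix t
      have "H ((f ^^ Q n) t + of_int (- p)) = H t + (real (Q n) * \<alpha> - of_int p)"
        unfolding H_plus_int H_funpow by simp
      then have "\<bar>((f ^^ Q n) t + of_int (- p)) - t\<bar> < \<eta>"
        using p elim \<delta>(2)[of "(f ^^ Q n) t + of_int (- p)" t] \<delta>(2)[of t "(f ^^ Q n) t + of_int (- p)"]
        by (simp only: abs_less_iff abs_le_iff) linarith
      from \<eta>(2)[OF this] show "\<bar>\<psi> ((f ^^ Q n) t) - \<psi> t\<bar> < \<epsilon>"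
        using quasiperiodic_int[of \<psi> 0 "(f ^^ Q n) t" "- p"] assms(2) by simp
    qed
  qed
qed

text \<open>
  Denjoy's distortion argument: on \<open>[x, y]\<close> the variation of \<open>ln (f\<^sup>i)'\<close> is at most \<open>M\<close> times the
  total length of the first \<open>i\<close> images, which overlap boundedly. Hence \<open>(f\<^sup>i)' x\<close> is comparable to
  the length of \<open>f\<^sup>i [x, y]\<close> divided by \<open>y - x\<close>.
\<close>

lemma distortion:
  assumes q: "approx_denom \<alpha> q" and xy: "x < y" "H y \<le> H x + 5 / real q" and "i < q"
  shows "(y - x) * Df i x \<le> exp (7 * M) * ((f ^^ i) y - (f ^^ i) x)"
    and "(f ^^ i) y - (f ^^ i) x \<le> exp (7 * M) * ((y - x) * Df i x)"
proof -
  obtain z where z: "x < z" "z < y" "(f ^^ i) y - (f ^^ i) x = (y - x) * Df i z"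
    using MVT2[of x y "f ^^ i" "Df i"] DERIV_funpow xy(1) by auto
  have "\<bar>ln (Df i z) - ln (Df i x)\<bar> \<le> (\<Sum>j<i. \<bar>ln (f' ((f ^^ j) z)) - ln (f' ((f ^^ j) x))\<bar>)"
    unfolding ln_Df birkhoff_def sum_subtractf[symmetric] by (rule sum_abs)
  also have "\<dots> \<le> (\<Sum>j<i. M * (f ^^ j) y - M * (f ^^ j) x)"
  proof (rule sum_mono)
    fix j
    have "(f ^^ j) x \<le> (f ^^ j) z" "(f ^^ j) z \<le> (f ^^ j) y" using z by (simp_all add: funpow_le)
    then have "M * \<bar>(f ^^ j) z - (f ^^ j) x\<bar> \<le> M * ((f ^^ j) y - (f ^^ j) x)"
      using M_nonneg by (intro mult_left_mono) auto
    then show "\<bar>ln (f' ((f ^^ j) z)) - ln (f' ((f ^^ j) x))\<bar> \<le> M * (f ^^ j) y - M * (f ^^ j) x"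
      using ln_f'_lipschitz[of "(f ^^ j) z" "(f ^^ j) x"] by (simp add: right_diff_distrib)
  qed
  also have "\<dots> \<le> (\<Sum>j<q. M * (f ^^ j) y - M * (f ^^ j) x)"
    using \<open>i < q\<close> xy(1) M_nonneg by (intro sum_mono2) (auto intro!: mult_left_mono funpow_le)
  also have "\<dots> \<le> real (5 + 2) * M"
    by (rule overlap_bound[OF q mono_scale_M]) (use xy(2) in \<open>simp_all add: algebra_simps\<close>)
  finally have "\<bar>ln (Df i z) - ln (Df i x)\<bar> \<le> 7 * M" by simp
  then have "ln (Df i x) - 7 * M \<le> ln (Df i z)" "ln (Df i z) \<le> ln (Df i x) + 7 * M" by linarith+
  then have "exp (ln (Df i x)) \<le> exp (7 * M + ln (Df i z))" "exp (ln (Df i z)) \<le> exp (7 * M + ln (Df i x))"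
    by simp_all
  then have "Df i x \<le> exp (7 * M) * Df i z" "Df i z \<le> exp (7 * M) * Df i x"
    by (simp_all add: exp_add Df_pos)
  from this[THEN mult_left_mono, of "y - x"] xy(1)
  show "(y - x) * Df i x \<le> exp (7 * M) * ((f ^^ i) y - (f ^^ i) x)"
    and "(f ^^ i) y - (f ^^ i) x \<le> exp (7 * M) * ((y - x) * Df i x)"
    unfolding z(3) by (simp_all add: mult.left_commute)
qed

section \<open>Spreading of averages\<close>

text \<open>
  The constant of \<open>eventually_averages_spread\<close>: two applications of \<open>distortion\<close> cost \<open>exp (14 M)\<close>, and
  \<open>7\<close> is the multiplicity of the images of a window.
\<close>

definition \<kappa> :: real
  where "\<kappa> = exp (- 14 * M) / 7"

lemma \<kappa>_bounds: "0 < \<kappa>" "\<kappa> \<le> 1"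
proof -
  have "exp (- 14 * M) \<le> 1" using M_nonneg by simp
  then show "0 < \<kappa>" "\<kappa> \<le> 1" unfolding \<kappa>_def by (simp, linarith)
qed
text \<open>
  A quantitative form of the ergodicity of \<open>f\<close> with respect to Lebesgue measure. Let \<open>[x, y]\<close> be
  a window. Up to distortion, \<open>(y - x) \<Sum> g (f\<^sup>j x) (f\<^sup>j)' x\<close> is the Riemann sum of \<open>g\<close> over the short
  intervals \<open>f\<^sup>j [x, y]\<close>; as they cover the circle, it is at least the integral \<open>I\<close> of \<open>g\<close> over a
  period, minus a small error. Up to distortion, \<open>(y - x) \<Sum> (f\<^sup>j)' x\<close> is their total length, at most \<open>7\<close>.
  The length \<open>y - x\<close> cancels in the comparison.
\<close>

lemma eventually_averages_spread:
  fixes g P :: "real \<Rightarrow> real"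
  assumes g: "continuous_on UNIV g" "\<And>t. g (t + 1) = g t" "\<And>t. 0 \<le> g t"
    and P: "\<And>t. (P has_real_derivative g t) (at t)" "\<And>t. P (t + 1) = P t + I"
    and "0 < \<epsilon>"
  shows "eventually (\<lambda>n. \<forall>x. (I - 7 * \<epsilon>) * \<kappa> * (\<Sum>j<Q n. Df j x)
    \<le> (\<Sum>j<Q n. g ((f ^^ j) x) * Df j x)) sequentially"
proof -
  obtain \<eta> where \<eta>: "0 < \<eta>" "\<And>s t. \<bar>s - t\<bar> < \<eta> \<Longrightarrow> \<bar>g s - g t\<bar> < \<epsilon>"
    using periodic_uniformly_continuous[OF g(1,2) \<open>0 < \<epsilon>\<close>] by metis
  obtain \<delta> where \<delta>: "0 < \<delta>" "\<And>s t. H t - H s < \<delta> \<Longrightarrow> t - s < \<eta>"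
    using H_mesh[OF \<eta>(1)] by metis
  have Pmono: "mono P"
  proof (rule monoI)
    fix a b :: real
    assume "a \<le> b"
    then show "P a \<le> P b"
      by (rule DERIV_nonneg_imp_nondecreasing) (use P(1) g(3) in blast)
  qed
  from eventually_Q_large[OF \<delta>(1), of 5] show ?thesis
  proof eventually_elim
    case (elim n)
    show ?case
    proof
      fix x
      define q where "q = Q n"
      have q: "approx_denom \<alpha> q" by (simp add: q_def Q_approx)
      obtain y where "x < y" and y3: "H x + 3 / real q < H y" and "H y < H x + 5 / real q"
        by (rule window[OF q])
      then have y: "x < y" "H y \<le> H x + 5 / real q" by simp_all
      define l where "l j = (f ^^ j) y - (f ^^ j) x" for j
      define S where "S = (\<Sum>j<q. g ((f ^^ j) x) * Df j x)"
      define D where "D = (\<Sum>j<q. Df j x)"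
      have l_pos: "0 < l j" for j using y(1) unfolding l_def by (simp add: funpow_less)
      have S0: "0 \<le> S" unfolding S_def using g(3) Df_pos by (intro sum_nonneg mult_nonneg_nonneg) (auto simp: less_imp_le)
      have D0: "0 \<le> D" unfolding D_def using Df_pos by (intro sum_nonneg) (auto simp: less_imp_le)
      have l_sum: "(\<Sum>j<q. l j) \<le> 7" 
      proof -
        have "(\<Sum>j<q. (f ^^ j) y - (f ^^ j) x) \<le> real (5 + 2) * 1"
          by (rule overlap_bound[OF q, where U = "\<lambda>t. t"]) (use y(2) in \<open>simp_all add: mono_def\<close>)
        then show ?thesis by (simp add: l_def)
      qed
      have step: "P ((f ^^ j) y) - P ((f ^^ j) x) \<le> (g ((f ^^ j) x) + \<epsilon>) * l j" if "j < q" for j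
      proof -
        obtain z where z: "(f ^^ j) x < z" "z < (f ^^ j) y"
          "P ((f ^^ j) y) - P ((f ^^ j) x) = l j * g z"
          using MVT2[of "(f ^^ j) x" "(f ^^ j) y" P g] P(1) l_pos[of j] unfolding l_def by auto
        have "H ((f ^^ j) y) - H ((f ^^ j) x) < \<delta>"
          using y(2) elim by (simp add: H_funpow q_def)
        from \<delta>(2)[OF this] have "\<bar>z - (f ^^ j) x\<bar> < \<eta>" using z(1,2) by simp
        then have "\<bar>g z - g ((f ^^ j) x)\<bar> < \<epsilon>" by (rule \<eta>(2))
        then have "g z \<le> g ((f ^^ j) x) + \<epsilon>" by linarith
        then have "g z * l j \<le> (g ((f ^^ j) x) + \<epsilon>) * l j"
          using l_pos[of j] by (intro mult_right_mono) simp_all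
        then show ?thesis unfolding z(3) by (simp only: mult.commute)
      qed
      have "I \<le> (\<Sum>j<q. P ((f ^^ j) y) - P ((f ^^ j) x))" 
        by (rule cover_bound[OF q Pmono P(2) y3])
      also have "\<dots> \<le> (\<Sum>j<q. (g ((f ^^ j) x) + \<epsilon>) * l j)" using step by (intro sum_mono) auto
      also have "\<dots> = (\<Sum>j<q. g ((f ^^ j) x) * l j) + \<epsilon> * (\<Sum>j<q. l j)"
        by (simp add: distrib_right sum.distrib sum_distrib_left)
      also have "\<dots> \<le> (\<Sum>j<q. g ((f ^^ j) x) * (exp (7 * M) * ((y - x) * Df j x))) + \<epsilon> * 7"
        using distortion(2)[OF q y] g(3) l_sum \<open>0 < \<epsilon>\<close>
        by (intro add_mono sum_mono mult_left_mono) (auto simp: l_def)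
      also have "\<dots> = exp (7 * M) * (y - x) * S + 7 * \<epsilon>"
        by (simp add: S_def sum_distrib_left mult_ac)
      finally have lower: "I - 7 * \<epsilon> \<le> exp (7 * M) * (y - x) * S" by simp
      have "(y - x) * D = (\<Sum>j<q. (y - x) * Df j x)" by (simp add: D_def sum_distrib_left)
      also have "\<dots> \<le> (\<Sum>j<q. exp (7 * M) * l j)"
        using distortion(1)[OF q y] by (intro sum_mono) (auto simp: l_def)
      also have "\<dots> \<le> exp (7 * M) * 7"
        using l_sum by (simp add: sum_distrib_left[symmetric])
      finally have upper: "(y - x) * D \<le> exp (7 * M) * 7" .
      have "(I - 7 * \<epsilon>) * D \<le> exp (7 * M) * (y - x) * S * D"
        using lower D0 by (rule mult_right_mono)
      also have "\<dots> = exp (7 * M) * S * ((y - x) * D)" by simp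
      also have "\<dots> \<le> exp (7 * M) * S * (exp (7 * M) * 7)"
        using upper S0 by (intro mult_left_mono) auto
      also have "\<dots> = 7 * (exp (7 * M) * exp (7 * M)) * S" by simp
      also have "exp (7 * M) * exp (7 * M) = exp (14 * M)" by (simp add: exp_add[symmetric])
      finally have "(I - 7 * \<epsilon>) * D * \<kappa> \<le> 7 * exp (14 * M) * S * \<kappa>"
        by (rule mult_right_mono) (use \<kappa>_bounds in simp)
      also have "\<dots> = S * (exp (14 * M) * exp (- 14 * M))" by (simp add: \<kappa>_def)
      also have "\<dots> = S" by (simp add: exp_minus)
      finally have "(I - 7 * \<epsilon>) * \<kappa> * D \<le> S" by (simp only: mult_ac)
      then show "(I - 7 * \<epsilon>) * \<kappa> * (\<Sum>j<Q n. Df j x) \<le> (\<Sum>j<Q n. g ((f ^^ j) x) * Df j x)"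
        unfolding S_def D_def q_def .
    qed
  qed
qed

section \<open>Contraction of the variation\<close>

text \<open>
  The number \<open>V\<close> bounds the variation of \<open>\<phi>\<close> over a period. The majorant \<open>u\<close> of \<open>\<bar>\<phi>'\<bar>\<close> is part of the
  data, together with a primitive \<open>U\<close>, so that all integrals are increments of explicit
  functions.
\<close>

definition dominated :: "(real \<Rightarrow> real) \<Rightarrow> real \<Rightarrow> bool"
  where "dominated \<phi> V \<longleftrightarrow> (\<exists>h U u.
    (\<forall>t. (\<phi> has_real_derivative h t) (at t)) \<and> continuous_on UNIV h \<and>
    (\<forall>t. (U has_real_derivative u t) (at t)) \<and> continuous_on UNIV u \<and>
    (\<forall>t. \<bar>h t\<bar> \<le> u t) \<and> (\<forall>t. \<phi> (t + 1) = \<phi> t) \<and> (\<forall>t. U (t + 1) = U t + V))"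

lemma dominated_koksma:
  assumes "dominated \<phi> V" "approx_denom \<alpha> q"
  shows "\<bar>birkhoff q \<phi> x - birkhoff q \<phi> y\<bar> \<le> 5 * V"
proof -
  from assms(1) obtain h U u where
    \<phi>: "\<And>t. (\<phi> has_real_derivative h t) (at t)" and U: "\<And>t. (U has_real_derivative u t) (at t)"
    and hu: "\<And>t. \<bar>h t\<bar> \<le> u t" and per: "\<And>t. \<phi> (t + 1) = \<phi> t" "\<And>t. U (t + 1) = U t + V"
    unfolding dominated_def by blast
  have "\<bar>\<phi> s - \<phi> t\<bar> \<le> U t - U s" if "s \<le> t" for s t
  proof -
    have "U s - \<phi> s \<le> U t - \<phi> t"
    proof (rule DERIV_nonneg_imp_nondecreasing[OF that, of "\<lambda>t. U t - \<phi> t"])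
      fix r
      have "0 \<le> u r - h r" using hu[of r] by linarith
      then show "\<exists>y. ((\<lambda>t. U t - \<phi> t) has_real_derivative y) (at r) \<and> 0 \<le> y"
        using DERIV_diff[OF U \<phi>] by blast
    qed
    moreover have "U s + \<phi> s \<le> U t + \<phi> t"
    proof (rule DERIV_nonneg_imp_nondecreasing[OF that, of "\<lambda>t. U t + \<phi> t"])
      fix r
      have "0 \<le> u r + h r" using hu[of r] by linarith
      then show "\<exists>y. ((\<lambda>t. U t + \<phi> t) has_real_derivative y) (at r) \<and> 0 \<le> y"
        using DERIV_add[OF U \<phi>] by blast
    qed
    ultimately show ?thesis by linarith
  qed
  moreover from this have "mono U" by (intro monoI) (smt (verit))
  ultimately show ?thesis using denjoy_koksma[OF assms(2)] per by blast
qed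

lemma birkhoff_f: "birkhoff k \<phi> (f t) - birkhoff k \<phi> t = \<phi> ((f ^^ k) t) - \<phi> t"
  by (induction k) (simp_all add: birkhoff_def funpow_swap1)

lemma birkhoff_periodic:
  assumes "\<And>t. \<phi> (t + 1) = \<phi> t"
  shows "birkhoff k \<phi> (t + 1) = birkhoff k \<phi> t"
  unfolding birkhoff_def by (simp add: funpow_plus_1 assms)

lemma birkhoff_cont: "continuous_on UNIV \<phi> \<Longrightarrow> continuous_on UNIV (birkhoff k \<phi>)"
  unfolding birkhoff_def by (intro continuous_on_sum compose_funpow_cont)

lemma DERIV_birkhoff:
  assumes "\<And>t. (\<phi> has_real_derivative h t) (at t)"
  shows "(birkhoff k \<phi> has_real_derivative (\<Sum>j<k. h ((f ^^ j) t) * Df j t)) (at t)"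
  unfolding birkhoff_def by (intro DERIV_sum DERIV_chain2[OF assms DERIV_funpow])

lemma weighted_sum_cont:
  assumes "continuous_on UNIV g"
  shows "continuous_on UNIV (\<lambda>t. \<Sum>j<k. g ((f ^^ j) t) * Df j t)"
  by (rule continuous_on_sum) (rule continuous_on_mult[OF compose_funpow_cont[OF assms] Df_cont])

text \<open>
  The contraction. The functions \<open>g\<^sub>\<plusminus> = (u \<plusminus> h) / 2\<close> are nonnegative and, since \<open>\<phi>\<close> is periodic, both
  have integral \<open>V / 2\<close>. By \<open>eventually_averages_spread\<close> both \<open>\<Sum> g\<^sub>\<plusminus> (f\<^sup>j t) (f\<^sup>j)' t\<close> dominate the
  same positive multiple of \<open>\<Sum> (f\<^sup>j)' t\<close>. This common part cancels in their difference, which is \<open>q\<close>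
  times the derivative of the average of \<open>\<phi>\<close>, so it can be removed from the majorant.
\<close>

lemma dominated_average:
  assumes "dominated \<phi> V" "0 < V"
  obtains q where "0 < q" "dominated (\<lambda>t. birkhoff q \<phi> t / real q) (V * (1 - \<kappa> / 2))"
proof -
  from assms(1) obtain h U u where
    \<phi>: "\<And>t. (\<phi> has_real_derivative h t) (at t)" "continuous_on UNIV h"
    and U: "\<And>t. (U has_real_derivative u t) (at t)" "continuous_on UNIV u"
    and hu: "\<And>t. \<bar>h t\<bar> \<le> u t" and per: "\<And>t. \<phi> (t + 1) = \<phi> t" "\<And>t. U (t + 1) = U t + V"
    unfolding dominated_def by blast
  have hper: "h (t + 1) = h t" for t using derivative_periodic[OF \<phi>(1), of 0] per by simp
  have uper: "u (t + 1) = u t" for t using derivative_periodic[OF U(1) per(2)] .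
  \<comment> \<open>Choosing the error \<open>\<epsilon> = V/28\<close> gives up half of the integral, \<open>V/2 - 7 \<epsilon> = V/4\<close>; the common part \<open>V \<kappa>/4\<close> of
     both sums can then be removed twice.\<close>
  define c where "c = V * \<kappa> / 2"
  have spread: "eventually (\<lambda>n. \<forall>x. (V / 2 - 7 * (V / 28)) * \<kappa> * (\<Sum>j<Q n. Df j x)
      \<le> (\<Sum>j<Q n. (u ((f ^^ j) x) + \<sigma> * h ((f ^^ j) x)) / 2 * Df j x)) sequentially"
    if \<sigma>: "\<sigma> = 1 \<or> \<sigma> = -1" for \<sigma> :: real
  proof (rule eventually_averages_spread)
    show "continuous_on UNIV (\<lambda>t. (u t + \<sigma> * h t) / 2)"
      by (intro continuous_intros U \<phi>) simp
    show "0 \<le> (u t + \<sigma> * h t) / 2" for t using hu[of t] \<sigma> by auto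
    show "((\<lambda>t. (U t + \<sigma> * \<phi> t) / 2) has_real_derivative (u t + \<sigma> * h t) / 2) (at t)" for t
      by (intro DERIV_cdivide DERIV_add U DERIV_cmult \<phi>)
  qed (use assms(2) in \<open>simp_all add: hper uper per field_simps\<close>)
  have "eventually (\<lambda>n. (\<forall>x. V / 4 * \<kappa> * (\<Sum>j<Q n. Df j x)
      \<le> (\<Sum>j<Q n. (u ((f ^^ j) x) + h ((f ^^ j) x)) / 2 * Df j x)) \<and>
     (\<forall>x. V / 4 * \<kappa> * (\<Sum>j<Q n. Df j x)
      \<le> (\<Sum>j<Q n. (u ((f ^^ j) x) - h ((f ^^ j) x)) / 2 * Df j x))) sequentially"
    using spread[of 1] spread[of "-1"] by (simp add: eventually_conj_iff)
  then obtain n where n: "\<And>x. V / 4 * \<kappa> * (\<Sum>j<Q n. Df j x)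
      \<le> (\<Sum>j<Q n. (u ((f ^^ j) x) + h ((f ^^ j) x)) / 2 * Df j x)"
     "\<And>x. V / 4 * \<kappa> * (\<Sum>j<Q n. Df j x)
      \<le> (\<Sum>j<Q n. (u ((f ^^ j) x) - h ((f ^^ j) x)) / 2 * Df j x)"
    by (auto simp: eventually_sequentially)
  define q where "q = Q n"
  have q0: "0 < q" using Q_approx[of n] by (simp add: q_def approx_denom_def)
  define h' where "h' t = (\<Sum>j<q. h ((f ^^ j) t) * Df j t) / real q" for t
  define U' where "U' t = (birkhoff q U t - c * birkhoff q (\<lambda>s. s) t) / real q" for t
  define u' where "u' t = ((\<Sum>j<q. u ((f ^^ j) t) * Df j t) - c * (\<Sum>j<q. 1 * Df j t)) / real q" for t
  have "((\<lambda>t. birkhoff q \<phi> t / real q) has_real_derivative h' t) (at t)" for t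
    unfolding h'_def by (rule DERIV_cdivide[OF DERIV_birkhoff[OF \<phi>(1)]])
  moreover have "(U' has_real_derivative u' t) (at t)" for t
    unfolding U'_def u'_def
    by (rule DERIV_cdivide[OF DERIV_diff[OF DERIV_birkhoff[OF U(1)]
            DERIV_cmult[OF DERIV_birkhoff[OF DERIV_ident]]]])
  moreover have "continuous_on UNIV h'"
    unfolding h'_def using q0
    by (intro continuous_on_divide[OF weighted_sum_cont[OF \<phi>(2)]] continuous_on_const) simp
  moreover have "continuous_on UNIV u'"
    unfolding u'_def using q0
    by (intro continuous_on_divide[OF continuous_on_diff[OF weighted_sum_cont[OF U(2)]
            continuous_on_mult[OF continuous_on_const
              weighted_sum_cont[OF continuous_on_const[of UNIV "1 :: real"]]]]] continuous_on_const) simp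
  moreover have "\<bar>h' t\<bar> \<le> u' t" for t
  proof -
    define Sh where "Sh = (\<Sum>j<q. h ((f ^^ j) t) * Df j t)"
    define Su where "Su = (\<Sum>j<q. u ((f ^^ j) t) * Df j t)"
    define D where "D = (\<Sum>j<q. Df j t)"
    have "(\<Sum>j<q. (u ((f ^^ j) t) + h ((f ^^ j) t)) / 2 * Df j t) = (Su + Sh) / 2"
      by (simp add: Su_def Sh_def add_divide_distrib distrib_right sum.distrib sum_divide_distrib)
    then have "c * D \<le> Su + Sh"
      using n(1)[of t] unfolding q_def[symmetric] D_def[symmetric] c_def by (simp add: mult_ac)
    have "(\<Sum>j<q. (u ((f ^^ j) t) - h ((f ^^ j) t)) / 2 * Df j t) = (Su - Sh) / 2"
      by (simp add: Su_def Sh_def diff_divide_distrib left_diff_distrib sum_subtractf sum_divide_distrib)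
    then have "c * D \<le> Su - Sh"
      using n(2)[of t] unfolding q_def[symmetric] D_def[symmetric] c_def by (simp add: mult_ac)
    with \<open>c * D \<le> Su + Sh\<close> have "\<bar>Sh\<bar> \<le> Su - c * D" by linarith
    then have "\<bar>Sh\<bar> / real q \<le> (Su - c * D) / real q" by (rule divide_right_mono) simp
    then show ?thesis by (simp add: h'_def u'_def Sh_def Su_def D_def)
  qed
  moreover have "birkhoff q \<phi> (t + 1) / real q = birkhoff q \<phi> t / real q" for t
    by (simp add: birkhoff_periodic per)
  moreover have "U' (t + 1) = U' t + V * (1 - \<kappa> / 2)" for t
  proof -
    have 1: "birkhoff q U (t + 1) = birkhoff q U t + real q * V"
      unfolding birkhoff_def by (simp add: funpow_plus_1 per sum.distrib)
    have 2: "birkhoff q (\<lambda>s. s) (t + 1) = birkhoff q (\<lambda>s. s) t + real q"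
      unfolding birkhoff_def by (simp add: funpow_plus_1 sum.distrib)
    show ?thesis unfolding U'_def 1 2 using q0 by (simp add: c_def field_simps)
  qed
  ultimately have "dominated (\<lambda>t. birkhoff q \<phi> t / real q) (V * (1 - \<kappa> / 2))"
    unfolding dominated_def by blast
  with q0 show ?thesis by (rule that)
qed

definition cohomologous :: "(real \<Rightarrow> real) \<Rightarrow> (real \<Rightarrow> real) \<Rightarrow> bool"
  where "cohomologous \<phi> \<phi>' \<longleftrightarrow> (\<exists>\<psi>. continuous_on UNIV \<psi> \<and> (\<forall>t. \<psi> (t + 1) = \<psi> t) \<and>
    (\<forall>t. \<phi>' t = \<phi> t + \<psi> (f t) - \<psi> t))"

lemma cohomologous_trans:
  assumes "cohomologous \<phi>1 \<phi>2" "cohomologous \<phi>2 \<phi>3"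
  shows "cohomologous \<phi>1 \<phi>3"
proof -
  from assms obtain \<psi> \<psi>' where
    "continuous_on UNIV \<psi>" "\<And>t. \<psi> (t + 1) = \<psi> t" "\<And>t. \<phi>2 t = \<phi>1 t + \<psi> (f t) - \<psi> t"
    "continuous_on UNIV \<psi>'" "\<And>t. \<psi>' (t + 1) = \<psi>' t" "\<And>t. \<phi>3 t = \<phi>2 t + \<psi>' (f t) - \<psi>' t"
    unfolding cohomologous_def by metis
  then show ?thesis unfolding cohomologous_def
    by (intro exI[of _ "\<lambda>t. \<psi> t + \<psi>' t"]) (auto intro!: continuous_on_add)
qed

text \<open>
  The transfer function is the average of the Birkhoff sums of length less than \<open>q\<close>.
\<close>

lemma cohomologous_average:
  assumes "continuous_on UNIV \<phi>" "\<And>t. \<phi> (t + 1) = \<phi> t" "0 < q"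
  shows "cohomologous \<phi> (\<lambda>t. birkhoff q \<phi> t / real q)"
  unfolding cohomologous_def
proof (intro exI conjI allI)
  show "continuous_on UNIV (\<lambda>t. (\<Sum>k<q. birkhoff k \<phi> t) / real q)"
    using assms by (intro continuous_on_divide continuous_on_sum birkhoff_cont continuous_on_const) auto
  show "(\<Sum>k<q. birkhoff k \<phi> (t + 1)) / real q = (\<Sum>k<q. birkhoff k \<phi> t) / real q" for t
    by (simp add: birkhoff_periodic assms)
  fix t
  have "(\<Sum>k<q. birkhoff k \<phi> (f t)) - (\<Sum>k<q. birkhoff k \<phi> t) = birkhoff q \<phi> t - real q * \<phi> t"
    unfolding sum_subtractf[symmetric] birkhoff_f by (simp add: sum_subtractf birkhoff_def)
  then have "((\<Sum>k<q. birkhoff k \<phi> (f t)) - (\<Sum>k<q. birkhoff k \<phi> t)) / real q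
      = birkhoff q \<phi> t / real q - \<phi> t"
    using assms(3) by (simp add: diff_divide_distrib)
  then show "birkhoff q \<phi> t / real q = \<phi> t + (\<Sum>k<q. birkhoff k \<phi> (f t)) / real q
      - (\<Sum>k<q. birkhoff k \<phi> t) / real q"
    by (simp add: diff_divide_distrib)
qed

lemma dominated_cont: "dominated \<phi> V \<Longrightarrow> continuous_on UNIV \<phi>"
  unfolding dominated_def by (meson DERIV_isCont continuous_at_imp_continuous_on)

lemma dominated_periodic: "dominated \<phi> V \<Longrightarrow> \<phi> (t + 1) = \<phi> t"
  unfolding dominated_def by blast

lemma cohomologous_dominated:
  assumes "dominated \<phi> V" "0 < V"
  shows "\<exists>\<phi>'. cohomologous \<phi> \<phi>' \<and> dominated \<phi>' (V * (1 - \<kappa> / 2) ^ n)"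
proof (induction n)
  case 0
  have "cohomologous \<phi> \<phi>" unfolding cohomologous_def by (intro exI[of _ "\<lambda>_. 0"]) auto
  with assms(1) show ?case by auto
next
  case (Suc n)
  then obtain \<phi>' where \<phi>': "cohomologous \<phi> \<phi>'" "dominated \<phi>' (V * (1 - \<kappa> / 2) ^ n)" by blast
  have "0 < V * (1 - \<kappa> / 2) ^ n" using \<kappa>_bounds assms(2) by simp
  then obtain q where q: "0 < q" "dominated (\<lambda>t. birkhoff q \<phi>' t / real q)
      (V * (1 - \<kappa> / 2) ^ n * (1 - \<kappa> / 2))"
    using dominated_average[OF \<phi>'(2)] by blast
  have "cohomologous \<phi>' (\<lambda>t. birkhoff q \<phi>' t / real q)"
    using dominated_cont[OF \<phi>'(2)] dominated_periodic[OF \<phi>'(2)] q(1) by (rule cohomologous_average)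
  with \<phi>'(1) have "cohomologous \<phi> (\<lambda>t. birkhoff q \<phi>' t / real q)" by (rule cohomologous_trans)
  with q(2) show ?case by (auto simp: mult_ac)
qed

text \<open>
  Replace \<open>\<phi>\<close> by a cohomologous function of small variation. Its Birkhoff sums oscillate little
  by the Denjoy--Koksma inequality, and the coboundary contributes \<open>\<psi> \<circ> f ^^ Q n - \<psi>\<close>, which tends
  to \<open>0\<close>.
\<close>

lemma birkhoff_oscillation:
  assumes "dominated \<phi> V" "0 < V" "0 < \<epsilon>"
  shows "eventually (\<lambda>n. \<forall>x y. \<bar>birkhoff (Q n) \<phi> x - birkhoff (Q n) \<phi> y\<bar> \<le> \<epsilon>) sequentially"
proof -
  have lim: "(\<lambda>n. 5 * (V * (1 - \<kappa> / 2) ^ n)) \<longlonglongrightarrow> 5 * (V * 0)"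
    using \<kappa>_bounds by (intro tendsto_mult tendsto_const LIMSEQ_realpow_zero) auto
  have "eventually (\<lambda>n. 5 * (V * (1 - \<kappa> / 2) ^ n) < \<epsilon> / 2) sequentially"
    by (rule order_tendstoD(2)[OF lim]) (use \<open>0 < \<epsilon>\<close> in simp)
  then obtain k where k: "5 * (V * (1 - \<kappa> / 2) ^ k) < \<epsilon> / 2"
    by (auto simp: eventually_sequentially)
  obtain \<phi>' where \<phi>': "cohomologous \<phi> \<phi>'" "dominated \<phi>' (V * (1 - \<kappa> / 2) ^ k)"
    using cohomologous_dominated[OF assms(1,2)] by blast
  then obtain \<psi> where \<psi>: "continuous_on UNIV \<psi>" "\<And>t. \<psi> (t + 1) = \<psi> t"
    "\<And>t. \<phi>' t = \<phi> t + \<psi> (f t) - \<psi> t"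
    unfolding cohomologous_def by blast
  have sums: "birkhoff q \<phi>' t = birkhoff q \<phi> t + (\<psi> ((f ^^ q) t) - \<psi> t)" for q t
    by (induction q) (simp_all add: birkhoff_def \<psi>(3))
  have "0 < \<epsilon> / 4" using \<open>0 < \<epsilon>\<close> by simp
  from eventually_return_close[OF \<psi>(1,2) this] show ?thesis
  proof eventually_elim
    case (elim n)
    show ?case
    proof (intro allI)
      fix x y
      have "\<bar>birkhoff (Q n) \<phi>' x - birkhoff (Q n) \<phi>' y\<bar> < \<epsilon> / 2"
        using dominated_koksma[OF \<phi>'(2) Q_approx, of n x y] k by linarith
      moreover have "\<bar>\<psi> ((f ^^ Q n) x) - \<psi> x\<bar> < \<epsilon> / 4" "\<bar>\<psi> ((f ^^ Q n) y) - \<psi> y\<bar> < \<epsilon> / 4"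
        using elim by blast+
      ultimately show "\<bar>birkhoff (Q n) \<phi> x - birkhoff (Q n) \<phi> y\<bar> \<le> \<epsilon>"
        unfolding sums by linarith
    qed
  qed
qed

end

section \<open>From the circle to the line\<close>

lemma to_circle_eq_iff: "to_circle x = to_circle y \<longleftrightarrow> x - y \<in> \<int>"
  by transfer simp

lemma to_circle_plus_1 [simp]: "to_circle (x + 1) = to_circle x"
  by (simp add: to_circle_eq_iff)

lemma circle_exhaust:
  obtains x where "c = to_circle x"
proof -
  have "\<exists>x. c = to_circle x" by transfer (metis Ints_0 diff_self)
  then show ?thesis using that by blast
qed

lemma continuous_on_circle:
  fixes g :: "circle \<Rightarrow> 'a::topological_space"
  assumes "continuous_on UNIV (\<lambda>x. g (to_circle x))"
  shows "continuous_on UNIV g"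
  using assms by (auto simp: continuous_on_open_vimage open_circle_def vimage_def)

lemma continuous_Ints_valued:
  fixes d :: "real \<Rightarrow> real"
  assumes "continuous_on UNIV d" "\<And>x. d x \<in> \<int>"
  obtains k where "\<And>x. d x = of_int k"
proof -
  have "\<exists>e>0. \<forall>y. y \<in> UNIV \<and> d y \<noteq> d x \<longrightarrow> e \<le> norm (d y - d x)" for x
  proof (intro exI[of _ 1] conjI allI impI)
    fix y assume "y \<in> UNIV \<and> d y \<noteq> d x"
    then show "1 \<le> norm (d y - d x)"
      using Ints_nonzero_abs_ge1[OF Ints_diff[OF assms(2) assms(2)], of y x] by simp
  qed simp
  then have "d constant_on UNIV"
    using assms(1) by (intro continuous_discrete_range_constant) auto
  then obtain c where "\<And>x. d x = c" by (auto simp: constant_on_def)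
  moreover obtain k where "d 0 = of_int k" using assms(2)[of 0] by (auto elim: Ints_cases)
  ultimately show ?thesis using that by metis
qed

lemma circle_lift_unique:
  assumes "circle_lift f F" "circle_lift g F"
  obtains k where "\<And>x. g x = f x + of_int k"
proof -
  have "to_circle (g x) = to_circle (f x)" for x using assms by (simp add: circle_lift_def)
  then have "g x - f x \<in> \<int>" for x by (simp add: to_circle_eq_iff)
  moreover have "continuous_on UNIV (\<lambda>x. g x - f x)"
    using assms by (auto simp: circle_lift_def intro: continuous_on_diff)
  ultimately obtain k where "\<And>x. g x - f x = of_int k" using continuous_Ints_valued by metis
  then show ?thesis using that by (metis add.commute diff_add_cancel)
qed

text \<open>
  The integer \<open>d = f (x + 1) - f x\<close> is positive by monotonicity. If it were at least \<open>2\<close>, some \<open>z\<close>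
  strictly between \<open>0\<close> and \<open>1\<close> would satisfy \<open>f z = f 0 + 1\<close>, against the injectivity of \<open>F\<close>.
\<close>

lemma circle_lift_degree_one:
  assumes f: "circle_lift f F" "strict_mono f" and "inj F"
  shows "f (x + 1) = f x + 1"
proof -
  have cont: "continuous_on UNIV f" and lift: "\<And>x. to_circle (f x) = F (to_circle x)"
    using f(1) by (auto simp: circle_lift_def)
  have "continuous_on UNIV (\<lambda>x. f (x + 1))"
    by (rule continuous_on_compose2[OF cont]) (auto intro!: continuous_intros)
  then have "circle_lift (\<lambda>x. f (x + 1)) F"
    using lift by (simp add: circle_lift_def)
  then obtain d where d: "\<And>x. f (x + 1) = f x + of_int d"
    using circle_lift_unique[OF f(1)] by metis
  have "f 0 < f (0 + 1)" using f(2) by (simp add: strict_mono_def)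
  then have "0 < d" using d[of 0] by simp
  have "\<not> 1 < d"
  proof
    assume "1 < d"
    then have "f 0 \<le> f 0 + 1" "f 0 + 1 < f 1" using d[of 0] by simp_all
    then obtain z where z: "0 \<le> z" "z \<le> 1" "f z = f 0 + 1"
      using IVT'[of f 0 "f 0 + 1" 1] cont by (auto intro: continuous_on_subset)
    then have "F (to_circle z) = F (to_circle 0)"
      using lift[of z] lift[of 0] by simp
    then have "to_circle z = to_circle 0" using \<open>inj F\<close> by (simp add: inj_eq)
    then have "z \<in> \<int>" by (simp add: to_circle_eq_iff)
    then obtain k where "z = of_int k" by (rule Ints_cases)
    moreover have "z \<noteq> 0" using z(3) by auto
    moreover have "z \<noteq> 1" using z(3) \<open>f 0 + 1 < f 1\<close> by auto
    ultimately show False using z(1,2) by auto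
  qed
  with \<open>0 < d\<close> have "d = 1" by simp
  then show ?thesis using d by simp
qed

lemma Ck_real_DERIV:
  assumes "Ck_real k f" "j < k"
  shows "((deriv ^^ j) f has_real_derivative (deriv ^^ Suc j) f x) (at x)"
  using assms by (simp add: Ck_real_def DERIV_deriv_iff_field_differentiable)

lemma Ck_real_cont:
  assumes "Ck_real k f" "j \<le> k"
  shows "continuous_on UNIV ((deriv ^^ j) f)"
proof (cases "j = k")
  case False
  then show ?thesis
    using Ck_real_DERIV[OF assms(1), of j] assms(2)
    by (intro continuous_at_imp_continuous_on ballI DERIV_isCont) auto
qed (use assms in \<open>simp add: Ck_real_def\<close>)

text \<open>
  A differentiable lift of the inverse of \<open>F\<close> is, up to an integer, a left inverse of \<open>f\<close>; the chain
  rule then excludes critical points.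
\<close>

lemma circle_diffeo_lift_deriv_pos:
  assumes F: "circle_diffeo k F" "0 < k"
    and f: "circle_lift f F" "strict_mono f" "\<And>x. (f has_real_derivative f' x) (at x)"
  shows "0 < f' x"
proof -
  obtain g where g: "circle_lift g (inv F)" "Ck_real k g" and "bij F"
    using F(1) unfolding circle_diffeo_def Ck_circle_map_def by blast
  have g': "(g has_real_derivative deriv g y) (at y)" for y
    using Ck_real_DERIV[OF g(2) F(2)] by simp
  have "continuous_on UNIV (\<lambda>x. g (f x))"
    using continuous_on_compose2[of UNIV g UNIV f] g(1) f(1) by (auto simp: circle_lift_def)
  moreover have "to_circle (g (f x)) = to_circle x" for x
    using g(1) f(1) \<open>bij F\<close> by (simp add: circle_lift_def bij_is_inj)
  ultimately have "circle_lift (\<lambda>x. g (f x)) id" by (simp add: circle_lift_def)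
  moreover have "circle_lift (\<lambda>x. x) id" by (simp add: circle_lift_def)
  ultimately obtain m where m: "\<And>x. g (f x) = x + of_int m"
    using circle_lift_unique by metis
  have "((\<lambda>x. g (f x)) has_real_derivative deriv g (f x) * f' x) (at x)"
    by (rule DERIV_chain2[OF g' f(3)])
  moreover have "((\<lambda>x. x + of_int m) has_real_derivative 1) (at x)"
    by (auto intro!: derivative_eq_intros)
  ultimately have "deriv g (f x) * f' x = 1" unfolding m by (rule DERIV_unique)
  then have "f' x \<noteq> 0" by auto
  moreover have "0 \<le> f' x"
  proof (rule ccontr)
    assume "\<not> 0 \<le> f' x"
    then obtain e where e: "0 < e" "\<And>h. 0 < h \<Longrightarrow> h < e \<Longrightarrow> f (x + h) < f x"
      using DERIV_neg_dec_right[OF f(3)] by (metis not_le)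
    have "f x < f (x + e / 2)" using f(2) e(1) by (simp add: strict_mono_def)
    moreover have "f (x + e / 2) < f x" using e(1) by (intro e(2)) auto
    ultimately show False by simp
  qed
  ultimately show ?thesis by simp
qed

lemma periodic_bounded:
  fixes g :: "real \<Rightarrow> real"
  assumes "continuous_on UNIV g" "\<And>t. g (t + 1) = g t"
  obtains B where "\<And>t. \<bar>g t\<bar> \<le> B"
proof -
  have "compact (g ` {0..1})"
    by (intro compact_continuous_image continuous_on_subset[OF assms(1)]) auto
  then obtain B where B: "\<And>y. y \<in> g ` {0..1} \<Longrightarrow> norm y \<le> B"
    using compact_imp_bounded bounded_iff by metis
  have "\<bar>g t\<bar> \<le> B" for t
  proof -
    have "0 \<le> t + of_int (- \<lfloor>t\<rfloor>)" "t + of_int (- \<lfloor>t\<rfloor>) \<le> 1" by (simp_all, linarith)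
    then have "norm (g (t + of_int (- \<lfloor>t\<rfloor>))) \<le> B" by (intro B imageI) simp
    then show ?thesis using quasiperiodic_int[of g 0 t "- \<lfloor>t\<rfloor>"] assms(2) by simp
  qed
  then show ?thesis by (rule that)
qed

text \<open>
  The derivative \<open>f'' / f'\<close> of \<open>ln f'\<close> is continuous and periodic, hence bounded.
\<close>

lemma ln_derivative_lipschitz:
  fixes f' :: "real \<Rightarrow> real"
  assumes f'': "\<And>t. (f' has_real_derivative f'' t) (at t)" "continuous_on UNIV f''"
    and f': "\<And>t. f' (t + 1) = f' t" "\<And>t. 0 < f' t"
  obtains M where "\<And>s t. \<bar>ln (f' s) - ln (f' t)\<bar> \<le> M * \<bar>s - t\<bar>"
proof -
  have "f'' (t + 1) = f'' t" for t
    using derivative_periodic[OF f''(1), of 0] f'(1) by simp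
  moreover have "continuous_on UNIV f'"
    using f''(1) by (intro continuous_at_imp_continuous_on ballI DERIV_isCont) auto
  then have "continuous_on UNIV (\<lambda>t. f'' t / f' t)"
    using f''(2) f'(2) by (intro continuous_on_divide) (auto simp: less_imp_neq[symmetric] dest: less_imp_neq)
  ultimately obtain M where M: "\<And>t. \<bar>f'' t / f' t\<bar> \<le> M"
    using periodic_bounded[of "\<lambda>t. f'' t / f' t"] f'(1) by auto
  have d: "((\<lambda>t. ln (f' t)) has_real_derivative f'' t / f' t) (at t)" for t
    using DERIV_chain2[OF DERIV_ln_divide[OF f'(2)] f''(1)[of t]] by simp
  have "norm (ln (f' s) - ln (f' t)) \<le> M * norm (s - t)" for s t
    by (rule field_differentiable_bound[of UNIV "\<lambda>t. ln (f' t)" "\<lambda>t. f'' t / f' t"])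
      (use d M in \<open>auto\<close>)
  then show ?thesis unfolding real_norm_def by (rule that)
qed

lemma invariant_integral_funpow:
  fixes \<phi> :: "circle \<Rightarrow> real"
  assumes "invariant_borel_probability F \<mu>" "\<phi> \<in> borel_measurable borel"
  shows "(\<lambda>y. \<phi> ((F ^^ i) y)) \<in> borel_measurable borel"
    and "(\<integral>y. \<phi> ((F ^^ i) y) \<partial>\<mu>) = (\<integral>y. \<phi> y \<partial>\<mu>)"
proof -
  have F: "F \<in> borel \<rightarrow>\<^sub>M borel" and inv: "distr \<mu> borel F = \<mu>" and s: "sets \<mu> = sets borel"
    using assms(1) by (auto simp: invariant_borel_probability_def)
  have FM: "F \<in> \<mu> \<rightarrow>\<^sub>M borel" using F s by (simp cong: measurable_cong_sets)
  have Fi: "(F ^^ i) \<in> borel \<rightarrow>\<^sub>M borel" for i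
  proof (induction i)
    case (Suc i)
    then show ?case using measurable_comp[OF Suc F] by (simp add: o_def)
  qed (simp add: id_def)
  have meas: "(\<lambda>y. \<phi> ((F ^^ i) y)) \<in> borel_measurable borel" for i
    by (rule measurable_compose[OF Fi assms(2)])
  show "(\<lambda>y. \<phi> ((F ^^ i) y)) \<in> borel_measurable borel" by (rule meas)
  show "(\<integral>y. \<phi> ((F ^^ i) y) \<partial>\<mu>) = (\<integral>y. \<phi> y \<partial>\<mu>)"
  proof (induction i)
    case (Suc i)
    have "(\<integral>y. \<phi> ((F ^^ i) y) \<partial>\<mu>) = (\<integral>y. \<phi> ((F ^^ i) y) \<partial>distr \<mu> borel F)" by (simp only: inv)
    also have "\<dots> = (\<integral>y. \<phi> ((F ^^ i) (F y)) \<partial>\<mu>)" by (rule integral_distr[OF FM meas])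
    finally show ?case using Suc by (simp add: funpow_swap1)
  qed simp
qed

lemma C0_norm_le:
  assumes "\<And>x. \<bar>g x\<bar> \<le> \<epsilon>"
  shows "\<bar>C0_norm g\<bar> \<le> \<epsilon>"
proof -
  have "C0_norm g \<le> \<epsilon>" unfolding C0_norm_def by (rule cSUP_least) (auto simp: assms)
  moreover have "\<bar>g undefined\<bar> \<le> C0_norm g"
    unfolding C0_norm_def by (rule cSUP_upper) (auto intro!: bdd_aboveI2 assms)
  ultimately show ?thesis by linarith
qed

text \<open>
  By invariance, integrating a Birkhoff sum of length \<open>q\<close> gives
  \<open>q\<close> times the integral of \<open>\<phi>\<close>, and a function of oscillation at most \<open>\<epsilon>\<close> is within \<open>\<epsilon>\<close> of its mean.
\<close>

lemma birkhoff_deviation: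
  fixes \<phi> :: "circle \<Rightarrow> real"
  assumes \<mu>: "invariant_borel_probability F \<mu>" and \<phi>: "continuous_on UNIV \<phi>" "\<And>y. \<bar>\<phi> y\<bar> \<le> B"
    and osc: "\<And>y. \<bar>(\<Sum>i<q. \<phi> ((F ^^ i) x)) - (\<Sum>i<q. \<phi> ((F ^^ i) y))\<bar> \<le> \<epsilon>"
  shows "\<bar>(\<Sum>i<q. \<phi> ((F ^^ i) x)) - real q * (\<integral>y. \<phi> y \<partial>\<mu>)\<bar> \<le> \<epsilon>"
proof -
  interpret prob_space \<mu> using \<mu> by (simp add: invariant_borel_probability_def)
  have s: "sets \<mu> = sets borel" using \<mu> by (simp add: invariant_borel_probability_def)
  have meas: "\<phi> \<in> borel_measurable borel" by (rule borel_measurable_continuous_onI[OF \<phi>(1)])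
  have int: "integrable \<mu> (\<lambda>y. \<phi> ((F ^^ i) y))" for i
    using invariant_integral_funpow(1)[OF \<mu> meas, of i] \<phi>(2) s
    by (intro integrable_const_bound[where B = B]) (auto cong: measurable_cong_sets)
  define S where "S y = (\<Sum>i<q. \<phi> ((F ^^ i) y))" for y
  have intS: "integrable \<mu> S" unfolding S_def by (intro Bochner_Integration.integrable_sum int)
  have "(\<integral>y. S y \<partial>\<mu>) = real q * (\<integral>y. \<phi> y \<partial>\<mu>)"
    unfolding S_def by (simp add: Bochner_Integration.integral_sum int invariant_integral_funpow(2)[OF \<mu> meas])
  moreover have "\<bar>\<integral>y. S x - S y \<partial>\<mu>\<bar> \<le> \<epsilon>"
  proof -
    have osc': "S x - S y \<le> \<epsilon>" "- \<epsilon> \<le> S x - S y" for y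
      using osc[of y] by (simp_all only: S_def abs_le_iff) linarith+
    have intd: "integrable \<mu> (\<lambda>y. S x - S y)"
      by (intro Bochner_Integration.integrable_diff intS) simp
    have "(\<integral>y. S x - S y \<partial>\<mu>) \<le> \<epsilon>" "- \<epsilon> \<le> (\<integral>y. S x - S y \<partial>\<mu>)"
      using integral_le_const[OF intd] integral_ge_const[OF intd] osc' by simp_all
    then show ?thesis by linarith
  qed
  moreover have "(\<integral>y. S x - S y \<partial>\<mu>) = S x - (\<integral>y. S y \<partial>\<mu>)"
    using intS by (simp add: prob_space)
  ultimately show ?thesis by (simp add: S_def)
qed

section \<open>The improved Denjoy--Koksma theorem\<close>

theorem corollaryC:
  fixes F :: "circle \<Rightarrow> circle" and \<phi> :: "circle \<Rightarrow> real"
    and \<mu> :: "circle measure" and \<alpha> :: real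
  assumes "circle_diffeo 11 F"
    and "orientation_preserving F"
    and "represents_rotation_number \<alpha> F"
    and "\<alpha> \<notin> \<rat>"
    and "invariant_borel_probability F \<mu>"
    and "Ck_circle_fun 1 \<phi>"
  shows "(\<lambda>n. C0_norm (\<lambda>x. (\<Sum>i<cf_denom \<alpha> n. \<phi> ((F ^^ i) x))
            - real (cf_denom \<alpha> n) * (\<integral>y. \<phi> y \<partial>\<mu>))) \<longlonglongrightarrow> 0"
proof -
  obtain f where f: "circle_lift f F" "\<And>x. (\<lambda>n. ((f ^^ n) x - x) / real n) \<longlonglongrightarrow> \<alpha>"
    using assms(3) unfolding represents_rotation_number_def by blast
  obtain f0 where f0: "circle_lift f0 F" "strict_mono f0"
    using assms(2) unfolding orientation_preserving_def by blast
  obtain f1 where f1: "circle_lift f1 F" "Ck_real 11 f1" and "inj F"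
    using assms(1) unfolding circle_diffeo_def Ck_circle_map_def bij_def by blast
  obtain k0 where k0: "\<And>x. f x = f0 x + of_int k0" using circle_lift_unique[OF f0(1) f(1)] by metis
  obtain k1 where k1: "\<And>x. f x = f1 x + of_int k1" using circle_lift_unique[OF f1(1) f(1)] by metis
  have f_mono: "strict_mono f" using f0(2) by (simp add: strict_mono_def k0)
  have f_per: "f (x + 1) = f x + 1" for x
    by (rule circle_lift_degree_one[OF f(1) f_mono \<open>inj F\<close>])
  define f' where "f' = deriv f1"
  define f'' where "f'' = deriv f'"
  have f'_deriv: "(f has_real_derivative f' x) (at x)" for x
  proof -
    have "((\<lambda>x. f1 x + of_int k1) has_real_derivative f' x + 0) (at x)"
      using Ck_real_DERIV[OF f1(2), of 0 x] by (intro DERIV_add DERIV_const) (simp add: f'_def)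
    then show ?thesis by (simp add: k1[abs_def])
  qed
  have f''_deriv: "(f' has_real_derivative f'' x) (at x)" for x
    using Ck_real_DERIV[OF f1(2), of 1 x] by (simp add: f'_def f''_def)
  have f'_cont: "continuous_on UNIV f'"
    using Ck_real_cont[OF f1(2), of 1] by (simp add: f'_def)
  have f''_cont: "continuous_on UNIV f''"
    using Ck_real_cont[OF f1(2), of 2] by (simp add: f'_def f''_def numeral_2_eq_2)
  have f'_per: "f' (x + 1) = f' x" for x by (rule derivative_periodic[OF f'_deriv f_per])
  have f'_pos: "0 < f' x" for x
    by (rule circle_diffeo_lift_deriv_pos[OF assms(1) _ f(1) f_mono f'_deriv]) simp
  obtain M where M: "\<And>s t. \<bar>ln (f' s) - ln (f' t)\<bar> \<le> M * \<bar>s - t\<bar>"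
    using ln_derivative_lipschitz[OF f''_deriv f''_cont f'_per f'_pos] by metis
  have Q_top: "filterlim (cf_denom \<alpha>) at_top sequentially"
    using cf_denom_ge[OF assms(4)] by (intro filterlim_at_top_mono[OF filterlim_ident]) simp
  interpret smooth_lift f \<alpha> f' M "cf_denom \<alpha>"
    by unfold_locales
      (rule f_mono f_per f(2) f'_deriv f'_pos f'_cont M approx_denom_cf_denom[OF assms(4)] Q_top)+

  define \<Phi> where "\<Phi> = \<phi> \<circ> to_circle"
  define h where "h = deriv \<Phi>"
  have \<Phi>: "(\<Phi> has_real_derivative h t) (at t)" "continuous_on UNIV h" "continuous_on UNIV \<Phi>" for t
    using assms(6) Ck_real_DERIV[of 1 \<Phi> 0 t] Ck_real_cont[of 1 \<Phi> 1] Ck_real_cont[of 1 \<Phi> 0]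
    by (simp_all add: Ck_circle_fun_def \<Phi>_def[symmetric] h_def)
  have \<Phi>_per: "\<Phi> (t + 1) = \<Phi> t" for t by (simp add: \<Phi>_def)
  have h_per: "h (t + 1) = h t" for t using derivative_periodic[OF \<Phi>(1), of 0] \<Phi>_per by simp
  obtain B where B: "\<And>t. \<bar>\<Phi> t\<bar> \<le> B" using periodic_bounded[OF \<Phi>(3) \<Phi>_per] by metis
  obtain V where V: "\<And>t. \<bar>h t\<bar> \<le> V" using periodic_bounded[OF \<Phi>(2) h_per] by metis
  have "0 \<le> V" using V[of 0] by linarith
  have dom: "dominated \<Phi> (V + 1)"
    unfolding dominated_def
  proof (rule exI[of _ h], rule exI[of _ "\<lambda>t. (V + 1) * t"], rule exI[of _ "\<lambda>_. V + 1"],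
      intro conjI allI)
    show "((\<lambda>t. (V + 1) * t) has_real_derivative V + 1) (at t)" for t
      by (auto intro!: derivative_eq_intros)
    show "\<bar>h t\<bar> \<le> V + 1" for t using V[of t] by linarith
  qed (simp_all add: \<Phi> \<Phi>_per algebra_simps)
  have orbit: "to_circle ((f ^^ i) t) = (F ^^ i) (to_circle t)" for i t
    using f(1) by (induction i) (simp_all add: circle_lift_def)
  have birkhoff_\<Phi>: "birkhoff q \<Phi> t = (\<Sum>i<q. \<phi> ((F ^^ i) (to_circle t)))" for q t
    by (simp add: birkhoff_def \<Phi>_def orbit)
  have \<phi>_cont: "continuous_on UNIV \<phi>"
    using \<Phi>(3) by (intro continuous_on_circle) (simp add: \<Phi>_def o_def)
  have \<phi>_bound: "\<bar>\<phi> c\<bar> \<le> B" for c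
    using B by (cases c rule: circle_exhaust) (simp add: \<Phi>_def)

  show ?thesis
  proof (rule LIMSEQ_I)
    fix r :: real
    assume "0 < r"
    then have "eventually (\<lambda>n. \<forall>x y. \<bar>birkhoff (cf_denom \<alpha> n) \<Phi> x - birkhoff (cf_denom \<alpha> n) \<Phi> y\<bar> \<le> r / 2)
        sequentially"
      using \<open>0 \<le> V\<close> by (intro birkhoff_oscillation[OF dom]) auto
    then obtain N where N: "\<And>n x y. N \<le> n \<Longrightarrow>
        \<bar>birkhoff (cf_denom \<alpha> n) \<Phi> x - birkhoff (cf_denom \<alpha> n) \<Phi> y\<bar> \<le> r / 2"
      by (auto simp: eventually_sequentially)
    have "\<bar>C0_norm (\<lambda>x. (\<Sum>i<cf_denom \<alpha> n. \<phi> ((F ^^ i) x))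
            - real (cf_denom \<alpha> n) * (\<integral>y. \<phi> y \<partial>\<mu>))\<bar> \<le> r / 2" if "N \<le> n" for n
    proof (intro C0_norm_le birkhoff_deviation[OF assms(5) \<phi>_cont \<phi>_bound])
      fix x y
      obtain s t where "x = to_circle s" "y = to_circle t" by (meson circle_exhaust)
      then show "\<bar>(\<Sum>i<cf_denom \<alpha> n. \<phi> ((F ^^ i) x)) - (\<Sum>i<cf_denom \<alpha> n. \<phi> ((F ^^ i) y))\<bar> \<le> r / 2"
        using N[OF that, of s t] by (simp add: birkhoff_\<Phi>)
    qed
    then show "\<exists>N. \<forall>n\<ge>N. norm (C0_norm (\<lambda>x. (\<Sum>i<cf_denom \<alpha> n. \<phi> ((F ^^ i) x))
            - real (cf_denom \<alpha> n) * (\<integral>y. \<phi> y \<partial>\<mu>)) - 0) < r"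
      using \<open>0 < r\<close> by (intro exI[of _ N] allI impI) fastforce
  qed
qed

end
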